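(* Let $A\in\mathbb{R}^{m\times n}$, $B\in\mathbb{R}^{s\times n}$, $b\in\mathbb{R}^m$, $d\in\mathbb{R}^s$ with $\mathrm{rank}(B)=s$ and $A^TJA$ positive definite, where $J=\mathrm{diag}(I_p,-I_q)$, $p+q=m$. Let $x$ be the unique solution of the EILS problem $\min_{x\in\mathbb{R}^n}(b-Ax)^TJ(b-Ax)$ subject to $Bx=d$, and put $M=A^TJA$, $N=BM^{-1}B^T$, $P=B^TN^{-1}BM^{-1}-I_n$, $r=b-Ax$, $\lambda=-(BB^T)^{-1}BA^TJr$. Let $L\in\mathbb{R}^{n\times k}$ with $\mathrm{rank}(L)=k$, and let $\Phi,\Psi,\beta,\vartheta,\xi_L$ be positive real numbers. Then the projected condition number $\kappa_{2L\mathcal{F}}(A,B,b,d)$ of the EILS problem with the Frobenius norm on the data space and the 2-norm on the projected solution space (defined in the context) equals both of the following two expressions (in the second, $x\neq0$ is understood so that $\mathcal{P}_x$ is defined): $$\kappa_{2L\mathcal{F}1}(A,B,b,d)=\left\|\xi_L^2L^T\mathcal{M}_{pa\mathcal{F}}\mathcal{M}_{pa\mathcal{F}}^TL\right\|_2^{1/2},$$ $$\kappa_{2L\mathcal{F}2}(A,B,b,d)=\left\|\xi_LL^T\begin{bmatrix}M^{-1}P\mathcal{Q}, & \frac{\gamma}{\Psi\vartheta}M^{-1}B^TN^{-1}+\frac{\vartheta}{\Psi\gamma}M^{-1}Px\lambda^T\end{bmatrix}\right\|_2,$$ where $$\mathcal{M}_{pa\mathcal{F}}\mathcal{M}_{pa\mathcal{F}}^T=M^{-1}PSP^TM^{-1}+\tfrac{1}{\Psi^2}M^{-1}Px\lambda^TN^{-1}BM^{-1}+\tfrac{1}{\Psi^2}M^{-1}B^TN^{-1}\lambda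 x^TP^TM^{-1}+\left(\tfrac{\|x\|_2^2}{\Psi^2}+\tfrac{1}{\vartheta^2}\right)M^{-1}B^TN^{-2}BM^{-1},$$ $$\mathcal{Q}=\begin{bmatrix}\frac{\zeta}{\Phi\beta}A^T-\frac{\beta}{\zeta\Phi}xr^T, & \frac{\|r\|_2}{\zeta}I_n, & \frac{\beta\|r\|_2\|x\|_2}{\zeta\Phi}\mathcal{P}_x, & \frac{\|\lambda\|_2}{\gamma}I_n, & \frac{\vartheta\|\lambda\|_2\|x\|_2}{\gamma\Psi}\mathcal{P}_x\end{bmatrix},$$ $\zeta=\sqrt{\beta^2\|x\|_2^2+\Phi^2}$, $\gamma=\sqrt{\vartheta^2\|x\|_2^2+\Psi^2}$, $$S=\left(\tfrac{\|\lambda\|_2^2}{\Psi^2}+\tfrac{\|r\|_2^2}{\Phi^2}\right)I_n+\left(\tfrac{\|x\|_2^2}{\Phi^2}+\tfrac{1}{\beta^2}\right)A^TA-\tfrac{1}{\Phi^2}xr^TA-\tfrac{1}{\Phi^2}A^Trx^T,$$ and $\mathcal{P}_x=I_n-\frac{1}{\|x\|_2^2}xx^T$.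
   Context: $\|\cdot\|_2$ is the Euclidean norm of vectors and the spectral norm of matrices. The solution map near the given data is $\mathcal{F}(A,B,b,d)=x=M^{-1}B^TN^{-1}d-P^TM^{-1}A^TJb$, the unique solution of the EILS problem; set $\mathcal{F}_L=L^T\mathcal{F}$. With positive scalar parameters, let $$\|\rho\circ\Delta\|_F=\sqrt{\Phi^2\|\Delta A\|_F^2+\Psi^2\|\Delta B\|_F^2+\beta^2\|\Delta b\|_2^2+\vartheta^2\|\Delta d\|_2^2}.$$ The 2-norm projected condition number is $$\kappa_{2L\mathcal{F}}(A,B,b,d)=\lim_{\delta\to0^+}\ \sup_{0<\|\rho\circ\Delta\|_F\le\delta}\frac{\xi_L\|\mathcal{F}_L(A+\Delta A,B+\Delta B,b+\Delta b,d+\Delta d)-\mathcal{F}_L(A,B,b,d)\|_2}{\|\rho\circ\Delta\|_F}.$$ The symbol $\mathcal{M}_{pa\mathcal{F}}\mathcal{M}_{pa\mathcal{F}}^T$ may be read simply as the name of the $n\times n$ matrix displayed in the claim. *)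

theory Defs
  imports "HOL-Analysis.Analysis"
begin

(* Conventions.  norm on real^'n is the Euclidean norm; norm on real^'n^'m is the L2 norm
   of the rows' L2 norms, i.e. the Frobenius norm of an 'm x 'n matrix. *)

definition spectral_norm :: "real^'n^'m \<Rightarrow> real"
  where "spectral_norm X = onorm ((*v) X)"

definition positive_definite :: "real^'n^'n \<Rightarrow> bool"
  where "positive_definite X \<longleftrightarrow> transpose X = X \<and> (\<forall>v. v \<noteq> 0 \<longrightarrow> 0 < v \<bullet> (X *v v))"

definition outer :: "real^'m \<Rightarrow> real^'n \<Rightarrow> real^'n^'m"
  where "outer u v = (\<chi> i j. u $ i * v $ j)"

(* The block row [X, Y]; its columns are indexed by the disjoint sum of the two index types. *)
definition hcat :: "real^'a^'n \<Rightarrow> real^'b^'n \<Rightarrow> real^('a + 'b)^'n"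
  where "hcat X Y = (\<chi> i j. case j of Inl a \<Rightarrow> X $ i $ a | Inr c \<Rightarrow> Y $ i $ c)"

(* diag(I_p, -I_q) with q = CARD('m) - p: the rows are ordered by the linear order of 'm, and i is
   among the first p of them iff fewer than p indices precede it. *)
definition signature_mat :: "nat \<Rightarrow> real^('m::{finite,linorder})^('m::{finite,linorder})"
  where "signature_mat p =
    (\<chi> i j. if i = j then (if card {k. k < i} < p then 1 else - 1) else 0)"

definition eils_objective ::
    "nat \<Rightarrow> real^'n^('m::{finite,linorder}) \<Rightarrow> real^('m::{finite,linorder}) \<Rightarrow> real^'n \<Rightarrow> real"
  where "eils_objective p A b y = (b - A *v y) \<bullet> (signature_mat p *v (b - A *v y))"

definition eils_solution ::
    "nat \<Rightarrow> real^'n^('m::{finite,linorder}) \<Rightarrow> real^'n^'s \<Rightarrow> real^('m::{finite,linorder}) \<Rightarrow> real^'s \<Rightarrow> real^'n \<Rightarrow> bool"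
  where "eils_solution p A B b d = is_arg_min (eils_objective p A b) (\<lambda>y. B *v y = d)"

definition eils_M :: "nat \<Rightarrow> real^'n^('m::{finite,linorder}) \<Rightarrow> real^'n^'n"
  where "eils_M p A = transpose A ** signature_mat p ** A"

definition eils_N :: "nat \<Rightarrow> real^'n^('m::{finite,linorder}) \<Rightarrow> real^'n^'s \<Rightarrow> real^'s^'s"
  where "eils_N p A B = B ** matrix_inv (eils_M p A) ** transpose B"

definition eils_P :: "nat \<Rightarrow> real^'n^('m::{finite,linorder}) \<Rightarrow> real^'n^'s \<Rightarrow> real^'n^'n"
  where "eils_P p A B =
    transpose B ** matrix_inv (eils_N p A B) ** B ** matrix_inv (eils_M p A) - mat 1"

(* The solution map. It is meaningful on the open set of data with B of full row rank and
   A^T J A positive definite, where it gives the unique EILS solution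
   (eils_solution_iff_eils_map below). *)
definition eils_map ::
    "nat \<Rightarrow> real^'n^('m::{finite,linorder}) \<Rightarrow> real^'n^'s \<Rightarrow> real^('m::{finite,linorder}) \<Rightarrow> real^'s \<Rightarrow> real^'n"
  where "eils_map p A B b d =
    (matrix_inv (eils_M p A) ** transpose B ** matrix_inv (eils_N p A B)) *v d
    - (transpose (eils_P p A B) ** matrix_inv (eils_M p A) ** transpose A ** signature_mat p) *v b"

definition projected_eils_map ::
    "real^'k^'n \<Rightarrow> nat \<Rightarrow> real^'n^('m::{finite,linorder}) \<Rightarrow> real^'n^'s \<Rightarrow> real^('m::{finite,linorder}) \<Rightarrow> real^'s \<Rightarrow> real^'k"
  where "projected_eils_map L p A B b d = transpose L *v eils_map p A B b d"

definition weighted_data_norm ::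
    "real \<Rightarrow> real \<Rightarrow> real \<Rightarrow> real \<Rightarrow> real^'n^'m \<Rightarrow> real^'n^'s \<Rightarrow> real^'m \<Rightarrow> real^'s \<Rightarrow> real"
  where "weighted_data_norm \<Phi> \<Psi> \<beta> \<theta> \<Delta>A \<Delta>B \<Delta>b \<Delta>d =
    sqrt (\<Phi>\<^sup>2 * (norm \<Delta>A)\<^sup>2 + \<Psi>\<^sup>2 * (norm \<Delta>B)\<^sup>2 + \<beta>\<^sup>2 * (norm \<Delta>b)\<^sup>2 + \<theta>\<^sup>2 * (norm \<Delta>d)\<^sup>2)"

(* The supremum is taken in the extended reals. It is monotone in \<delta>, so the one-sided limit
   always exists there and Lim never returns an arbitrary value. *)
definition projected_cond ::
    "real \<Rightarrow> real \<Rightarrow> real \<Rightarrow> real \<Rightarrow> real \<Rightarrow> real^'k^'n \<Rightarrow> nat \<Rightarrow>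
     real^'n^('m::{finite,linorder}) \<Rightarrow> real^'n^'s \<Rightarrow> real^('m::{finite,linorder}) \<Rightarrow> real^'s \<Rightarrow> ereal"
  where "projected_cond \<Phi> \<Psi> \<beta> \<theta> \<xi> L p A B b d =
    Lim (at_right 0) (\<lambda>\<delta>::real.
      SUP (\<Delta>A, \<Delta>B, \<Delta>b, \<Delta>d) \<in>
          {(\<Delta>A, \<Delta>B, \<Delta>b, \<Delta>d). 0 < weighted_data_norm \<Phi> \<Psi> \<beta> \<theta> \<Delta>A \<Delta>B \<Delta>b \<Delta>d
                             \<and> weighted_data_norm \<Phi> \<Psi> \<beta> \<theta> \<Delta>A \<Delta>B \<Delta>b \<Delta>d \<le> \<delta>}.
        ereal (\<xi> * norm (projected_eils_map L p (A + \<Delta>A) (B + \<Delta>B) (b + \<Delta>b) (d + \<Delta>d)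
                          - projected_eils_map L p A B b d)
               / weighted_data_norm \<Phi> \<Psi> \<beta> \<theta> \<Delta>A \<Delta>B \<Delta>b \<Delta>d))"

lemma transpose_signature_mat: "transpose (signature_mat p) = signature_mat p"
  by (auto simp: transpose_def signature_mat_def vec_eq_iff)

lemma positive_definite_invertible:
  fixes X :: "real^'n^'n"
  assumes "positive_definite X"
  shows "invertible X"
proof -
  have "v = 0" if "X *v v = 0" for v
    using assms that unfolding positive_definite_def by (metis inner_zero_right less_irrefl)
  then show ?thesis
    by (metis invertible_left_inverse matrix_left_invertible_ker)
qed

lemma matrix_inv_mult:
  fixes X :: "real^'n^'n"
  assumes "invertible X"
  shows "X *v (matrix_inv X *v v) = v" "matrix_inv X *v (X *v v) = v"
proof -
  have "X ** matrix_inv X = mat 1 \<and> matrix_inv X ** X = mat 1"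
    using assms unfolding matrix_inv_def invertible_def by (rule someI_ex)
  then show "X *v (matrix_inv X *v v) = v" "matrix_inv X *v (X *v v) = v"
    by (simp_all add: matrix_vector_mul_assoc)
qed

lemma transpose_matrix_inv_symmetric:
  fixes X :: "real^'n^'n"
  assumes "invertible X" "transpose X = X"
  shows "transpose (matrix_inv X) = matrix_inv X"
proof -
  have "X ** matrix_inv X = mat 1"
    using matrix_inv_mult(1)[OF assms(1)] by (simp add: matrix_eq matrix_vector_mul_assoc[symmetric])
  then have "transpose (matrix_inv X) ** X = mat 1"
    by (metis assms(2) matrix_transpose_mul transpose_mat)
  then have "transpose (matrix_inv X) *v (X *v v) = v" for v
    by (simp add: matrix_vector_mul_assoc)
  then have "transpose (matrix_inv X) *v v = matrix_inv X *v v" for v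
    by (metis matrix_inv_mult(1)[OF assms(1)])
  then show ?thesis by (simp add: matrix_eq)
qed

lemma eils_solution_iff_eils_map:
  fixes A :: "real^'n^('m::{finite,linorder})" and B :: "real^'n^'s"
  assumes rB: "rank B = CARD('s)" and pd: "positive_definite (eils_M p A)"
  shows "eils_solution p A B b d y \<longleftrightarrow> y = eils_map p A B b d"
proof -
  define J M N where "J = (signature_mat p :: real^('m::{finite,linorder})^('m::{finite,linorder}))"
    and "M = eils_M p A" and "N = eils_N p A B"
  define Mi Ni where "Mi = matrix_inv M" and "Ni = matrix_inv N"
  have invM: "invertible M" and symM: "transpose M = M"
    using pd positive_definite_invertible by (auto simp: M_def positive_definite_def)
  have symMi: "transpose Mi = Mi"
    using transpose_matrix_inv_symmetric[OF invM symM] by (simp add: Mi_def)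
  note [simp del] = transpose_matrix_vector
  have M1: "M *v (Mi *v v) = v" "Mi *v (M *v v) = v" for v
    using matrix_inv_mult[OF invM] by (simp_all add: Mi_def)
  have tr: "u \<bullet> (transpose X *v v) = (X *v u) \<bullet> v" for X :: "real^'a^'b" and u v
    by (metis dot_lmul_matrix inner_commute transpose_matrix_vector)
  have Mpos: "0 < v \<bullet> (M *v v)" if "v \<noteq> 0" for v
    using pd that by (auto simp: M_def positive_definite_def)
  have Nv: "N *v v = B *v (Mi *v (transpose B *v v))" for v
    by (simp only: N_def eils_N_def Mi_def M_def matrix_vector_mul_assoc matrix_mul_assoc)
  have Bt: "v = 0" if "transpose B *v v = 0" for v
  proof -
    have "inj ((*v) (transpose B))"
      using rB full_rank_injective[of "transpose B"] rank_transpose[of B] by simp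
    then show ?thesis using that by (metis injD matrix_vector_mult_0_right)
  qed
  have "v = 0" if "N *v v = 0" for v
  proof -
    let ?w = "Mi *v (transpose B *v v)"
    have "?w \<bullet> (M *v ?w) = v \<bullet> (N *v v)"
      unfolding Nv M1 using tr[of ?w B v] by (simp add: inner_commute)
    then have "?w = 0" using that Mpos[of ?w] by (metis inner_zero_right less_irrefl)
    then show ?thesis using Bt M1(1) by (metis matrix_vector_mult_0_right)
  qed
  then have invN: "invertible N"
    by (metis invertible_left_inverse matrix_left_invertible_ker)
  have symN: "transpose N = N"
    using symMi by (simp add: N_def eils_N_def Mi_def M_def matrix_transpose_mul matrix_mul_assoc)
  have symNi: "transpose Ni = Ni"
    using transpose_matrix_inv_symmetric[OF invN symN] by (simp add: Ni_def)
  have N1: "N *v (Ni *v v) = v" for v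
    using matrix_inv_mult[OF invN] by (simp add: Ni_def)
  have tP: "transpose (eils_P p A B) = Mi ** transpose B ** Ni ** B - mat 1"
  proof -
    have "transpose (X - Y) = transpose X - transpose Y" for X Y :: "real^'n^'n"
      by (simp add: transpose_def vec_eq_iff)
    then show ?thesis
      using symMi symNi
      by (simp add: eils_P_def Mi_def[symmetric] Ni_def[symmetric] M_def[symmetric] N_def[symmetric]
          matrix_transpose_mul matrix_mul_assoc)
  qed
  define c where "c = transpose A *v (J *v b)"
  define w where "w = Ni *v (d - B *v (Mi *v c))"
  define y0 where "y0 = eils_map p A B b d"
  have y0: "y0 = Mi *v c + Mi *v (transpose B *v w)"
    unfolding y0_def eils_map_def tP w_def c_def J_def
    by (simp add: Mi_def[symmetric] Ni_def[symmetric] M_def[symmetric] N_def[symmetric]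
        matrix_vector_mul_assoc[symmetric] matrix_vector_mult_diff_rdistrib
        matrix_vector_mult_diff_distrib)
  have By0: "B *v y0 = d"
    unfolding y0 matrix_vector_right_distrib Nv[symmetric] w_def N1 by simp
  have My0: "M *v y0 = c + transpose B *v w"
    unfolding y0 matrix_vector_right_distrib M1 ..
  have Mv: "M *v v = transpose A *v (J *v (A *v v))" for v
    by (simp only: M_def eils_M_def J_def matrix_vector_mul_assoc matrix_mul_assoc)
  have symJ: "u \<bullet> (J *v v) = (J *v u) \<bullet> v" for u v
    using tr[of u J v] by (simp add: J_def transpose_signature_mat)
  have obj: "eils_objective p A b y
      = eils_objective p A b y0 + (y - y0) \<bullet> (M *v (y - y0))" if "B *v y = d" for y
  proof -
    let ?z = "y - y0" and ?r = "b - A *v y0"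
    have "B *v ?z = 0" using that By0 by (simp add: matrix_vector_mult_diff_distrib)
    then have "?z \<bullet> (transpose B *v w) = 0" by (simp add: tr)
    moreover have "transpose A *v (J *v ?r) = - (transpose B *v w)"
      using My0 by (simp add: matrix_vector_mult_diff_distrib c_def Mv)
    ultimately have *: "(A *v ?z) \<bullet> (J *v ?r) = 0"
      using tr[of ?z A "J *v ?r"] by (simp del: transpose_matrix_vector)
    have split: "b - A *v y = ?r - A *v ?z"
      by (simp add: matrix_vector_mult_diff_distrib)
    have "eils_objective p A b y = (?r - A *v ?z) \<bullet> (J *v (?r - A *v ?z))"
      unfolding eils_objective_def J_def split ..
    also have "\<dots> = ?r \<bullet> (J *v ?r) - ?r \<bullet> (J *v (A *v ?z)) - (A *v ?z) \<bullet> (J *v ?r)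
        + (A *v ?z) \<bullet> (J *v (A *v ?z))"
      unfolding matrix_vector_mult_diff_distrib[of J ?r "A *v ?z"]
      by (simp only: inner_diff_left inner_diff_right)
    also have "?r \<bullet> (J *v (A *v ?z)) = 0"
      using * symJ[of ?r "A *v ?z"] by (simp add: inner_commute)
    also have "(A *v ?z) \<bullet> (J *v (A *v ?z)) = ?z \<bullet> (M *v ?z)"
      unfolding Mv by (simp only: tr)
    finally show ?thesis using * by (simp add: eils_objective_def J_def)
  qed
  show ?thesis
  proof
    assume y: "eils_solution p A B b d y"
    then have "B *v y = d" "eils_objective p A b y \<le> eils_objective p A b y0"
      using By0 by (auto simp: eils_solution_def is_arg_min_linorder)
    then show "y = eils_map p A B b d"
      using obj[of y] Mpos[of "y - y0"] by (auto simp: y0_def[symmetric])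
  next
    assume "y = eils_map p A B b d"
    then have "y = y0" by (simp add: y0_def)
    moreover have "eils_objective p A b y0 \<le> eils_objective p A b u" if "B *v u = d" for u
      using obj[OF that] Mpos[of "u - y0"] by (cases "u = y0") auto
    ultimately show "eils_solution p A B b d y"
      using By0 by (auto simp: eils_solution_def is_arg_min_linorder)
  qed
qed

end

theory Submission
  imports Defs
begin

text \<open>
  After rescaling the data by the weights, the condition number is the operator norm of the
  Frechet derivative of the projected solution map. That derivative comes from differentiating the
  KKT system \<open>A\<^sup>T J (b - A x) + B\<^sup>T \<lambda> = 0\<close>, \<open>B x = d\<close>: with \<open>K = M\<^sup>-\<^sup>1 P\<close> (symmetric) and
  \<open>H = M\<^sup>-\<^sup>1 B\<^sup>T N\<^sup>-\<^sup>1\<close>,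
  \<open>dx = H (dd - dB x) - K (dA\<^sup>T J r + A\<^sup>T J (db - dA x) + dB\<^sup>T \<lambda>)\<close>.
  If \<open>D\<close> is the derivative and \<open>G\<close> its adjoint, the norm of \<open>D\<close> is the square root of that of
  \<open>D G\<close>. Both closed forms arise from Gram identities: \<open>D G = \<xi>\<^sup>2 L\<^sup>T MM L\<close>, and the block row \<open>W\<close> of
  the second form satisfies \<open>W W\<^sup>T = D G\<close>.
\<close>

declare transpose_matrix_vector [simp del]

subsection \<open>Difference quotients and operator norms\<close>

text \<open>Close to \<open>x\<close> the quotient of \<open>f\<close> differs arbitrarily little
  from \<open>norm (D h) / norm h\<close>, and the latter depends only on the direction of
  \<open>h\<close>. So every small sphere already shows the full operator norm.\<close>

lemma SUP_difference_quotient_tendsto_onorm: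
  fixes f :: "'a::euclidean_space \<Rightarrow> 'b::real_normed_vector"
  assumes f: "(f has_derivative D) (at x)"
  shows "((\<lambda>\<delta>. SUP h\<in>{h. 0 < norm h \<and> norm h \<le> \<delta>}. ereal (norm (f (x + h) - f x) / norm h))
    \<longlongrightarrow> ereal (onorm D)) (at_right 0)"
proof -
  define q where "q \<delta> = (SUP h\<in>{h. 0 < norm h \<and> norm h \<le> \<delta>}. ereal (norm (f (x + h) - f x) / norm h))"
    for \<delta>
  have D: "bounded_linear D"
    using f by (rule has_derivative_bounded_linear)
  have key: "\<forall>\<^sub>F \<delta> in at_right 0. ereal (onorm D - e) \<le> q \<delta> \<and> q \<delta> \<le> ereal (onorm D + e)" if "e > 0" for e
  proof -
    \<comment> \<open>One half of \<open>e\<close> is spent on the linearization error, the other on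
      approximating the supremum in \<open>onorm D\<close>.\<close>
    have "\<forall>\<^sub>F h in at 0. norm (f (x + h) - f x - D h) / norm h < e / 2"
      using f \<open>e > 0\<close> unfolding has_derivative_at by (intro order_tendstoD(2)[of _ 0]) auto
    then obtain d0 where d0: "d0 > 0"
      and small: "\<And>h. h \<noteq> 0 \<Longrightarrow> norm h < d0 \<Longrightarrow> norm (f (x + h) - f x - D h) / norm h < e / 2"
      unfolding eventually_at by (auto simp: dist_norm)
    have near: "\<bar>norm (f (x + h) - f x) / norm h - norm (D h) / norm h\<bar> < e / 2"
      if "h \<noteq> 0" "norm h < d0" for h
    proof -
      have "\<bar>norm (f (x + h) - f x) / norm h - norm (D h) / norm h\<bar>
          = \<bar>norm (f (x + h) - f x) - norm (D h)\<bar> / norm h"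
        by (simp add: diff_divide_distrib[symmetric])
      also have "\<dots> \<le> norm (f (x + h) - f x - D h) / norm h"
        by (intro divide_right_mono norm_triangle_ineq3) auto
      also have "\<dots> < e / 2" using small that by blast
      finally show ?thesis .
    qed
    have "ereal (onorm D - e) \<le> q \<delta> \<and> q \<delta> \<le> ereal (onorm D + e)" if \<delta>: "0 < \<delta>" "\<delta> < d0" for \<delta>
    proof
      \<comment> \<open>The supremum in \<open>onorm\<close> also ranges over the zero vector, whose
        quotient is 0 by division by zero. Should that vector be the approximate maximizer, the
        bound is negative and any basis vector serves.\<close>
      obtain v where v: "v \<noteq> 0" "onorm D - e / 2 < norm (D v) / norm v"
      proof -
        have "\<exists>v. onorm D - e / 2 < norm (D v) / norm v"
        proof (rule ccontr)
          assume "\<nexists>v. onorm D - e / 2 < norm (D v) / norm v"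
          then have "onorm D \<le> onorm D - e / 2"
            unfolding onorm_def[of D] by (intro cSUP_least) (auto simp: not_less)
          then show False using \<open>e > 0\<close> by simp
        qed
        then obtain w where w: "onorm D - e / 2 < norm (D w) / norm w" ..
        obtain i :: 'a where i: "i \<in> Basis" using nonempty_Basis by blast
        show ?thesis
        proof (cases "w = 0")
          case True
          then have "onorm D - e / 2 < 0" using w by simp
          also have "0 \<le> norm (D i) / norm i" by simp
          finally show ?thesis using that[of i] nonzero_Basis[OF i] by blast
        qed (use that w in auto)
      qed
      \<comment> \<open>Rescaling to norm \<open>\<delta>\<close> puts the vector into the range of
        the supremum and leaves the quotient of \<open>D\<close> unchanged.\<close>
      define h where "h = (\<delta> / norm v) *\<^sub>R v"
      have h: "h \<noteq> 0" "norm h = \<delta>" "norm (D h) / norm h = norm (D v) / norm v"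
        using v \<delta> by (auto simp: h_def linear_simps(5)[OF D])
      have "onorm D - e \<le> norm (f (x + h) - f x) / norm h"
        using near[of h] h v \<delta> by linarith
      then have "ereal (onorm D - e) \<le> ereal (norm (f (x + h) - f x) / norm h)"
        by simp
      also have "\<dots> \<le> q \<delta>"
        unfolding q_def using h by (intro SUP_upper) auto
      finally show "ereal (onorm D - e) \<le> q \<delta>" .
      show "q \<delta> \<le> ereal (onorm D + e)"
        unfolding q_def
      proof (rule SUP_least)
        fix h :: 'a assume "h \<in> {h. 0 < norm h \<and> norm h \<le> \<delta>}"
        then have h: "h \<noteq> 0" "norm h < d0" using \<delta> by auto
        have "norm (f (x + h) - f x) / norm h \<le> onorm D + e"
          using near[OF h] le_onorm[OF D, of h] \<open>e > 0\<close> by linarith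
        then show "ereal (norm (f (x + h) - f x) / norm h) \<le> ereal (onorm D + e)"
          by simp
      qed
    qed
    then show ?thesis
      using d0 unfolding eventually_at_right_field by auto
  qed
  show ?thesis
    unfolding q_def[symmetric]
  proof (rule order_tendstoI)
    fix a assume a: "a < ereal (onorm D)"
    \<comment> \<open>\<open>a\<close> may be minus infinity; a real \<open>c\<close> in between
      supplies the finite tolerance \<open>onorm D - c\<close>.\<close>
    then obtain c where c: "a < ereal c" "c < onorm D"
      by (metis ereal_dense2 ereal_less(2) less_ereal.simps(1))
    show "\<forall>\<^sub>F \<delta> in at_right 0. a < q \<delta>"
      using key[of "onorm D - c"] c by (auto elim!: eventually_mono)
  next
    fix a assume a: "ereal (onorm D) < a"
    then obtain c where c: "ereal c < a" "onorm D < c"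
      by (metis ereal_dense2 less_ereal.simps(1))
    show "\<forall>\<^sub>F \<delta> in at_right 0. q \<delta> < a"
      using key[of "c - onorm D"] c by (auto elim!: eventually_mono)
  qed
qed

section \<open>Operator norms of adjoints and Gram operators\<close>

lemma onorm_le_onorm_adjoint:
  fixes f :: "'a::euclidean_space \<Rightarrow> 'b::euclidean_space"
  assumes g: "bounded_linear g" and adj: "\<And>x y. f x \<bullet> y = x \<bullet> g y"
  shows "onorm f \<le> onorm g"
proof (rule onorm_bound[OF onorm_pos_le[OF g]])
  fix x
  have "norm (f x) * norm (f x) = x \<bullet> g (f x)"
    by (metis adj power2_eq_square power2_norm_eq_inner)
  also have "\<dots> \<le> norm x * norm (g (f x))"
    by (rule norm_cauchy_schwarz)
  also have "\<dots> \<le> norm x * (onorm g * norm (f x))"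
    by (intro mult_left_mono onorm[OF g]) auto
  finally show "norm (f x) \<le> onorm g * norm x"
    by (cases "f x = 0") (auto simp: onorm_pos_le[OF g] mult_ac)
qed

lemma onorm_adjoint_eq:
  fixes f :: "'a::euclidean_space \<Rightarrow> 'b::euclidean_space"
  assumes "bounded_linear f" "bounded_linear g" "\<And>x y. f x \<bullet> y = x \<bullet> g y"
  shows "onorm f = onorm g"
  using onorm_le_onorm_adjoint[of g f] onorm_le_onorm_adjoint[of f g] assms
  by (metis antisym inner_commute)

text \<open>The C*-identity: \<open>gram\<close> makes \<open>C\<close> the adjoint of
  \<open>g\<close> composed with \<open>g\<close>. Cauchy-Schwarz bounds \<open>onorm C\<close> by
  the square of \<open>onorm g\<close>, testing \<open>C y\<close> against \<open>y\<close> gives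
  the converse, and adjoints share their norm. With \<open>gram\<close> given as a bilinear form,
  different factorizations of the same \<open>C\<close> can be compared without multiplying out
  matrices.\<close>

lemma onorm_eq_sqrt_onorm_gram:
  fixes f :: "'a::euclidean_space \<Rightarrow> 'b::euclidean_space"
  assumes f: "bounded_linear f" and g: "bounded_linear g" and C: "bounded_linear C"
    and adj: "\<And>x y. f x \<bullet> y = x \<bullet> g y"
    and gram: "\<And>y z. C y \<bullet> z = g y \<bullet> g z"
  shows "onorm f = sqrt (onorm C)"
proof -
  have "onorm C \<le> (onorm g)\<^sup>2"
  proof (rule onorm_bound)
    fix y
    have "norm (C y) * norm (C y) = g y \<bullet> g (C y)"
      by (metis gram power2_eq_square power2_norm_eq_inner)
    also have "\<dots> \<le> norm (g y) * norm (g (C y))"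
      by (rule norm_cauchy_schwarz)
    also have "\<dots> \<le> (onorm g * norm y) * (onorm g * norm (C y))"
      by (intro mult_mono onorm[OF g]) (auto simp: onorm_pos_le[OF g])
    finally have "norm (C y) * norm (C y) \<le> ((onorm g)\<^sup>2 * norm y) * norm (C y)"
      by (simp add: power2_eq_square mult_ac)
    then show "norm (C y) \<le> (onorm g)\<^sup>2 * norm y"
      by (cases "C y = 0") auto
  qed simp
  moreover have "onorm g \<le> sqrt (onorm C)"
  proof (rule onorm_bound)
    fix y
    have "(norm (g y))\<^sup>2 = C y \<bullet> y"
      by (metis gram power2_norm_eq_inner)
    also have "\<dots> \<le> norm (C y) * norm y"
      by (rule norm_cauchy_schwarz)
    also have "\<dots> \<le> onorm C * norm y * norm y"
      by (intro mult_right_mono onorm[OF C]) auto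
    also have "\<dots> = (sqrt (onorm C) * norm y)\<^sup>2"
      by (simp add: power_mult_distrib onorm_pos_le[OF C] power2_eq_square)
    finally show "norm (g y) \<le> sqrt (onorm C) * norm y"
      by (rule power2_le_imp_le) (simp add: onorm_pos_le[OF C])
  qed (simp add: onorm_pos_le[OF C])
  ultimately have "onorm g = sqrt (onorm C)"
    using real_sqrt_le_mono[of "onorm C" "(onorm g)\<^sup>2"] by (simp add: onorm_pos_le[OF g])
  then show ?thesis using onorm_adjoint_eq[OF f g adj] by simp
qed

subsection \<open>Differentiability of matrix expressions\<close>

lemma differentiable_vec_nthI:
  fixes f :: "'a::real_normed_vector \<Rightarrow> ('b::euclidean_space)^'n"
  assumes "\<And>i. (\<lambda>z. f z $ i) differentiable (at x within S)"
  shows "f differentiable (at x within S)"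
proof -
  obtain f' where f': "\<And>i. ((\<lambda>z. f z $ i) has_derivative f' i) (at x within S)"
    using assms unfolding differentiable_def by metis
  have "(f has_derivative (\<lambda>h. \<chi> i. f' i h)) (at x within S)"
    unfolding has_derivative_componentwise_within[of f]
  proof
    fix e :: "'b^'n" assume "e \<in> Basis"
    then obtain i u where e: "e = axis i u"
      unfolding Basis_vec_def by auto
    show "((\<lambda>z. f z \<bullet> e) has_derivative (\<lambda>h. (\<chi> i. f' i h) \<bullet> e)) (at x within S)"
      unfolding e inner_axis by (auto intro!: derivative_eq_intros f')
  qed
  then show ?thesis by (rule differentiableI)
qed

lemma differentiable_vec_nth:
  fixes f :: "'a::real_normed_vector \<Rightarrow> ('b::real_normed_vector)^'n"
  assumes "f differentiable (at x within S)"
  shows "(\<lambda>z. f z $ i) differentiable (at x within S)"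
proof -
  obtain f' where "(f has_derivative f') (at x within S)"
    using assms unfolding differentiable_def by blast
  from bounded_linear.has_derivative[OF bounded_linear_vec_nth this]
  show ?thesis by (rule differentiableI)
qed

lemma differentiable_prod:
  fixes f :: "'i \<Rightarrow> 'a::real_normed_vector \<Rightarrow> real"
  assumes "\<And>i. i \<in> I \<Longrightarrow> f i differentiable (at x within S)"
  shows "(\<lambda>z. \<Prod>i\<in>I. f i z) differentiable (at x within S)"
proof -
  obtain f' where "\<And>i. i \<in> I \<Longrightarrow> (f i has_derivative f' i) (at x within S)"
    using assms unfolding differentiable_def by metis
  then show ?thesis
    using has_derivative_prod[of I f f'] unfolding differentiable_def by blast
qed

lemma differentiable_det:
  fixes f :: "'a::real_normed_vector \<Rightarrow> real^'n^'n"
  assumes "\<And>i j. (\<lambda>z. f z $ i $ j) differentiable (at x within S)"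
  shows "(\<lambda>z. det (f z)) differentiable (at x within S)"
  unfolding det_def
  by (intro differentiable_sum differentiable_mult differentiable_const differentiable_prod assms
      finite_permutations finite ballI) 

lemma differentiable_matrix_mult:
  fixes f :: "'a::real_normed_vector \<Rightarrow> real^'n^'m" and g :: "'a \<Rightarrow> real^'k^'n"
  assumes "f differentiable (at x within S)" "g differentiable (at x within S)"
  shows "(\<lambda>z. f z ** g z) differentiable (at x within S)"
  unfolding matrix_matrix_mult_def
  by (intro differentiable_vec_nthI, simp)
    (intro differentiable_sum differentiable_mult differentiable_vec_nth assms ballI finite)

lemma differentiable_matrix_vector_mult:
  fixes f :: "'a::real_normed_vector \<Rightarrow> real^'n^'m" and g :: "'a \<Rightarrow> real^'n"
  assumes "f differentiable (at x within S)" "g differentiable (at x within S)"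
  shows "(\<lambda>z. f z *v g z) differentiable (at x within S)"
  unfolding matrix_vector_mult_def
  by (intro differentiable_vec_nthI, simp)
    (intro differentiable_sum differentiable_mult differentiable_vec_nth assms ballI finite)

lemma differentiable_transpose:
  fixes f :: "'a::real_normed_vector \<Rightarrow> real^'n^'m"
  assumes "f differentiable (at x within S)"
  shows "(\<lambda>z. transpose (f z)) differentiable (at x within S)"
  unfolding transpose_def
  by (intro differentiable_vec_nthI, simp) (intro differentiable_vec_nth assms)

text \<open>Column \<open>l\<close> of the inverse solves a linear system with right-hand side
  \<open>axis l 1\<close>, so Cramer's rule applies. A quotient of determinants is rational in the
  entries, which makes inversion differentiable.\<close>

lemma matrix_inv_cramer:
  fixes X :: "real^'n^'n"
  assumes "invertible X"
  shows "matrix_inv X $ k $ l = det (\<chi> i j. if j = k then (if i = l then 1 else 0) else X $ i $ j) / det X"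
proof -
  have "X *v (matrix_inv X *v axis l 1) = axis l 1"
    by (rule matrix_inv_mult[OF assms])
  then have "matrix_inv X *v axis l 1 =
      (\<chi> k. det (\<chi> i j. if j = k then axis l 1 $ i else X $ i $ j) / det X)"
    using cramer[of X] assms by (simp add: invertible_det_nz)
  then have "(matrix_inv X *v axis l 1) $ k =
      det (\<chi> i j. if j = k then axis l 1 $ i else X $ i $ j) / det X"
    by simp
  moreover have "(matrix_inv X *v axis l 1) $ k = matrix_inv X $ k $ l"
    by (simp add: matrix_vector_mult_basis column_def)
  moreover have "(\<chi> i j. if j = k then axis l 1 $ i else X $ i $ j) =
      (\<chi> i j. if j = k then (if i = l then 1 else 0) else X $ i $ j)"
    by (simp add: vec_eq_iff axis_def)
  ultimately show ?thesis by simp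
qed

text \<open>The determinant is continuous along \<open>f\<close>, so being nonzero persists
  nearby.\<close>

lemma eventually_invertible:
  fixes f :: "'a::real_normed_vector \<Rightarrow> real^'n^'n"
  assumes f: "f differentiable (at x)" and inv: "invertible (f x)"
  shows "\<forall>\<^sub>F z in at x. invertible (f z)"
proof -
  have "(\<lambda>z. det (f z)) differentiable (at x)"
    by (intro differentiable_det differentiable_vec_nth f)
  then have "((\<lambda>z. det (f z)) \<longlongrightarrow> det (f x)) (at x)"
    using differentiable_imp_continuous_within isContD by blast
  then show ?thesis
    using inv tendsto_imp_eventually_ne unfolding invertible_det_nz by blast
qed

lemma differentiable_matrix_inv:
  fixes f :: "'a::real_normed_vector \<Rightarrow> real^'n^'n"
  assumes f: "f differentiable (at x)" and inv: "invertible (f x)"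
  shows "(\<lambda>z. matrix_inv (f z)) differentiable (at x)"
proof -
  let ?c = "\<lambda>z k l. det (\<chi> i j. if j = k then (if i = l then 1 else 0) else f z $ i $ j) / det (f z)"
  have "(\<lambda>z. \<chi> k l. ?c z k l) differentiable (at x)"
  proof (intro differentiable_vec_nthI)
    fix k l
    have entry: "(\<lambda>z. (\<chi> i j. if j = k then if i = l then 1 else 0 else f z $ i $ j) $ i $ j)
        differentiable (at x)" for i j
      using differentiable_vec_nth[OF differentiable_vec_nth[OF f], of i j]
      by (cases "j = k") auto
    have "(\<lambda>z. ?c z k l) differentiable (at x)"
    proof (rule differentiable_divide[OF differentiable_det[OF entry]])
      show "(\<lambda>z. det (f z)) differentiable (at x)"
        by (intro differentiable_det differentiable_vec_nth f)
      show "det (f x) \<noteq> 0" using inv by (simp add: invertible_det_nz)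
    qed
    then show "(\<lambda>z. (\<chi> k l. ?c z k l) $ k $ l) differentiable (at x)"
      by (simp only: vec_lambda_beta)
  qed
  then obtain D where D: "((\<lambda>z. \<chi> k l. ?c z k l) has_derivative D) (at x)"
    unfolding differentiable_def by blast
  have eq: "(\<chi> k l. ?c z k l) = matrix_inv (f z)" if "invertible (f z)" for z
    using matrix_inv_cramer[OF that] by (simp add: vec_eq_iff)
  \<comment> \<open>The Cramer quotient is known to equal \<open>matrix_inv\<close> only at
    invertible matrices, so the two are exchanged on a neighbourhood and at \<open>x\<close>
    itself.\<close>
  have "((\<lambda>z. matrix_inv (f z)) has_derivative D) (at x)"
    using D eventually_mono[OF eventually_invertible[OF f inv] eq] eq[OF inv]
    by (rule has_derivative_transform_eventually) simp_all
  then show ?thesis by (rule differentiableI)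
qed

subsection \<open>The KKT system and its linearization\<close>

lemma inner_transpose_matrix_vector:
  fixes X :: "real^'n^'m"
  shows "u \<bullet> (transpose X *v v) = (X *v u) \<bullet> v"
  by (metis dot_lmul_matrix inner_commute transpose_matrix_vector)

lemma bounded_bilinear_matrix_vector_mult:
  "bounded_bilinear (\<lambda>(X :: real^'n^'m) v. X *v v)"
  unfolding bilinear_conv_bounded_bilinear[symmetric] bilinear_def
  by (auto intro!: linearI simp: matrix_vector_mult_add_rdistrib matrix_vector_right_distrib
      scaleR_matrix_vector_assoc matrix_vector_mult_scaleR)

lemma bounded_linear_transpose: "bounded_linear (transpose :: real^'n^'m \<Rightarrow> real^'m^'n)"
  by (auto simp: linear_conv_bounded_linear[symmetric] transpose_def vec_eq_iff intro!: linearI)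

lemma inj_transpose_full_row_rank:
  fixes B :: "real^'n^'s"
  assumes "rank B = CARD('s)"
  shows "inj ((*v) (transpose B))"
  using assms full_rank_injective[of "transpose B"] rank_transpose[of B] by simp

lemma invertible_if_kernel_trivial:
  fixes X :: "real^'n^'n"
  assumes "\<And>v. X *v v = 0 \<Longrightarrow> v = 0"
  shows "invertible X"
  using assms by (metis invertible_left_inverse matrix_left_invertible_ker)

text \<open>A kernel vector \<open>v\<close> makes the squared norm of B^T v vanish, and B^T is
  injective by full row rank. This gives meaning to the inverse in the formula for
  \<lambda>.\<close>

lemma invertible_self_mult_transpose:
  fixes B :: "real^'n^'s"
  assumes "rank B = CARD('s)"
  shows "invertible (B ** transpose B)"
proof (rule invertible_if_kernel_trivial)
  fix v assume "(B ** transpose B) *v v = 0"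
  then have "(transpose B *v v) \<bullet> (transpose B *v v) = 0"
    by (metis inner_commute inner_transpose_matrix_vector inner_zero_left matrix_vector_mul_assoc)
  then show "v = 0"
    using inj_transpose_full_row_rank[OF assms] by (auto simp: inj_def dest: spec[of _ v] spec[of _ 0])
qed

section \<open>Symmetry and invertibility of M and N\<close>

lemma transpose_eils_M: "transpose (eils_M p A) = eils_M p A"
  by (simp add: eils_M_def matrix_transpose_mul transpose_signature_mat matrix_mul_assoc)

lemma transpose_matrix_inv_eils_M:
  assumes "invertible (eils_M p A)"
  shows "transpose (matrix_inv (eils_M p A)) = matrix_inv (eils_M p A)"
  using assms transpose_eils_M by (rule transpose_matrix_inv_symmetric)

lemma transpose_eils_N:
  assumes "invertible (eils_M p A)"
  shows "transpose (eils_N p A B) = eils_N p A B"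
  by (simp add: eils_N_def matrix_transpose_mul transpose_matrix_inv_eils_M[OF assms] matrix_mul_assoc)

lemma transpose_matrix_inv_eils_N:
  assumes "invertible (eils_M p A)" "invertible (eils_N p A B)"
  shows "transpose (matrix_inv (eils_N p A B)) = matrix_inv (eils_N p A B)"
  using assms(2) transpose_eils_N[OF assms(1)] by (rule transpose_matrix_inv_symmetric)

text \<open>With w = M^-1 B^T v the quadratic forms satisfy w.Mw = v.Nv. So Nv = 0 forces w = 0 by
  definiteness of M, and then v = 0 by injectivity of B^T.\<close>

lemma invertible_eils_N:
  fixes A :: "real^'n^('m::{finite,linorder})" and B :: "real^'n^'s"
  assumes rB: "rank B = CARD('s)" and pd: "positive_definite (eils_M p A)"
  shows "invertible (eils_N p A B)"
proof (rule invertible_if_kernel_trivial)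
  fix v assume v: "eils_N p A B *v v = 0"
  note M = matrix_inv_mult(1)[OF positive_definite_invertible[OF pd]]
  let ?w = "matrix_inv (eils_M p A) *v (transpose B *v v)"
  have "?w \<bullet> (eils_M p A *v ?w) = v \<bullet> (eils_N p A B *v v)"
    unfolding M inner_transpose_matrix_vector
    by (simp add: eils_N_def matrix_vector_mul_assoc matrix_mul_assoc inner_commute)
  then have "?w = 0"
    using pd v unfolding positive_definite_def by (metis inner_zero_right less_irrefl)
  then have "transpose B *v v = 0"
    using M by (metis matrix_vector_mult_0_right)
  then show "v = 0"
    using inj_transpose_full_row_rank[OF rB] by (auto simp: inj_def dest: spec[of _ v] spec[of _ 0])
qed

lemma transpose_eils_P:
  fixes A :: "real^'n^('m::{finite,linorder})"
  assumes "invertible (eils_M p A)" "invertible (eils_N p A B)"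
  shows "transpose (eils_P p A B) =
    matrix_inv (eils_M p A) ** transpose B ** matrix_inv (eils_N p A B) ** B - mat 1"
proof -
  have "transpose (X - Y) = transpose X - transpose Y" for X Y :: "real^'n^'n"
    by (simp add: transpose_def vec_eq_iff)
  then show ?thesis
    by (simp add: eils_P_def matrix_transpose_mul matrix_mul_assoc
        transpose_matrix_inv_eils_M[OF assms(1)] transpose_matrix_inv_eils_N[OF assms])
qed

text \<open>The Lagrange multiplier as it results from eliminating the solution from the KKT system.
  In this form it is differentiable in the data by the same rules as the solution;
  \<open>eils_multiplier_eq\<close> links it to the \<lambda> of the claim.\<close>

definition eils_multiplier ::
    "nat \<Rightarrow> real^'n^('m::{finite,linorder}) \<Rightarrow> real^'n^'s \<Rightarrow> real^('m::{finite,linorder}) \<Rightarrow> real^'s \<Rightarrow> real^'s"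
  where "eils_multiplier p A B b d = matrix_inv (eils_N p A B) *v
    (d - B *v (matrix_inv (eils_M p A) *v (transpose A *v (signature_mat p *v b))))"

text \<open>The solution map has the form M^-1 (c + B^T w). Applying M yields stationarity, and
  applying B yields the constraint because N w = d - B M^-1 c. Invertibility is an open condition,
  so both equations hold identically near the given data and can be differentiated.\<close>

lemma eils_KKT:
  assumes M: "invertible (eils_M p A)" and N: "invertible (eils_N p A B)"
  shows "transpose A *v (signature_mat p *v (b - A *v eils_map p A B b d))
      + transpose B *v eils_multiplier p A B b d = 0"
    and "B *v eils_map p A B b d = d"
proof -
  define c where "c = transpose A *v (signature_mat p *v b)"
  define w where "w = eils_multiplier p A B b d"
  note M1 = matrix_inv_mult[OF M] and N1 = matrix_inv_mult[OF N]
  have y: "eils_map p A B b d = matrix_inv (eils_M p A) *v (c + transpose B *v w)"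
    by (simp add: eils_map_def transpose_eils_P[OF M N] w_def eils_multiplier_def c_def
        matrix_vector_mul_assoc[symmetric] matrix_vector_mult_diff_rdistrib
        matrix_vector_mult_diff_distrib matrix_vector_right_distrib)
  have "eils_M p A *v eils_map p A B b d = c + transpose B *v w"
    unfolding y M1 ..
  then show "transpose A *v (signature_mat p *v (b - A *v eils_map p A B b d))
      + transpose B *v eils_multiplier p A B b d = 0"
    by (simp add: c_def w_def eils_M_def matrix_vector_mult_diff_distrib
        matrix_vector_mul_assoc[symmetric])
  have "B *v eils_map p A B b d
      = B *v (matrix_inv (eils_M p A) *v c) + eils_N p A B *v w"
    by (simp add: y matrix_vector_right_distrib eils_N_def matrix_vector_mul_assoc[symmetric])
  also have "\<dots> = d"
    by (simp add: w_def eils_multiplier_def N1 c_def)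
  finally show "B *v eils_map p A B b d = d" .
qed

lemma differentiable_eils:
  assumes A: "A differentiable (at z)" and B: "B differentiable (at z)"
    and b: "b differentiable (at z)" and d: "d differentiable (at z)"
    and M: "invertible (eils_M p (A z))" and N: "invertible (eils_N p (A z) (B z))"
  shows "(\<lambda>z. eils_M p (A z)) differentiable (at z)"
    and "(\<lambda>z. eils_N p (A z) (B z)) differentiable (at z)"
    and "(\<lambda>z. eils_map p (A z) (B z) (b z) (d z)) differentiable (at z)"
    and "(\<lambda>z. eils_multiplier p (A z) (B z) (b z) (d z)) differentiable (at z)"
proof -
  show M': "(\<lambda>z. eils_M p (A z)) differentiable (at z)"
    unfolding eils_M_def
    by (intro differentiable_matrix_mult differentiable_transpose A differentiable_const)
  note Mi = differentiable_matrix_inv[OF M' M]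
  show N': "(\<lambda>z. eils_N p (A z) (B z)) differentiable (at z)"
    unfolding eils_N_def
    by (intro differentiable_matrix_mult differentiable_transpose Mi B)
  note Ni = differentiable_matrix_inv[OF N' N]
  show "(\<lambda>z. eils_map p (A z) (B z) (b z) (d z)) differentiable (at z)"
    unfolding eils_map_def eils_P_def
    by (intro differentiable_matrix_mult differentiable_matrix_vector_mult differentiable_diff
        differentiable_transpose differentiable_const A B b d Mi Ni)
  show "(\<lambda>z. eils_multiplier p (A z) (B z) (b z) (d z)) differentiable (at z)"
    unfolding eils_multiplier_def
    by (intro differentiable_matrix_mult differentiable_matrix_vector_mult differentiable_diff
        differentiable_transpose differentiable_const A B b d Mi Ni)
qed

text \<open>Block elimination: M^-1 expresses \<open>u\<close> through \<open>w\<close>, applying B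
  turns the constraint into an equation for N w, and substituting back leaves M^-1 (B^T N^-1 B M^-1
  - I) = M^-1 P in front of \<open>g\<close>.\<close>

lemma solve_linearized_KKT:
  assumes M: "invertible (eils_M p A)" and N: "invertible (eils_N p A B)"
    and grad: "eils_M p A *v u = g + transpose B *v w" and con: "B *v u = e"
  shows "u = (matrix_inv (eils_M p A) ** transpose B ** matrix_inv (eils_N p A B)) *v e
    - (matrix_inv (eils_M p A) ** eils_P p A B) *v g"
proof -
  note M1 = matrix_inv_mult[OF M] and N1 = matrix_inv_mult[OF N]
  have u: "u = matrix_inv (eils_M p A) *v (g + transpose B *v w)"
    using M1(2)[of u] unfolding grad by (rule sym)
  have "e = B *v (matrix_inv (eils_M p A) *v g) + eils_N p A B *v w"
    unfolding con[symmetric] u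
    by (simp add: matrix_vector_right_distrib eils_N_def matrix_vector_mul_assoc[symmetric])
  then have w: "w = matrix_inv (eils_N p A B) *v (e - B *v (matrix_inv (eils_M p A) *v g))"
    by (simp add: N1)
  show ?thesis
    unfolding u w eils_P_def
    by (simp add: matrix_vector_mul_assoc[symmetric] matrix_vector_mult_diff_rdistrib
        matrix_vector_mult_diff_distrib matrix_vector_right_distrib)
qed

text \<open>Differentiating the KKT system, which holds identically near \<open>z\<close>, gives a linear system
  for the derivatives of the solution and of the multiplier; no formula for the derivative of a
  matrix inverse is needed.\<close>

lemma has_derivative_eils_map:
  fixes A :: "'z::real_normed_vector \<Rightarrow> real^'n^('m::{finite,linorder})" and B :: "'z \<Rightarrow> real^'n^'s"
  assumes A: "(A has_derivative A') (at z)" and B: "(B has_derivative B') (at z)"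
    and b: "(b has_derivative b') (at z)" and d: "(d has_derivative d') (at z)"
    and M: "invertible (eils_M p (A z))" and N: "invertible (eils_N p (A z) (B z))"
    and x: "x = eils_map p (A z) (B z) (b z) (d z)"
    and lam: "lam = eils_multiplier p (A z) (B z) (b z) (d z)"
  shows "((\<lambda>z. eils_map p (A z) (B z) (b z) (d z)) has_derivative
    (\<lambda>h. (matrix_inv (eils_M p (A z)) ** transpose (B z) ** matrix_inv (eils_N p (A z) (B z)))
          *v (d' h - B' h *v x)
      - (matrix_inv (eils_M p (A z)) ** eils_P p (A z) (B z)) *v
        (transpose (A' h) *v (signature_mat p *v (b z - A z *v x))
         + transpose (A z) *v (signature_mat p *v (b' h - A' h *v x))
         + transpose (B' h) *v lam))) (at z)"
proof -
  note diff = differentiable_eils[OF differentiableI[OF A] differentiableI[OF B]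
      differentiableI[OF b] differentiableI[OF d] M N]
  define X where "X = (\<lambda>z. eils_map p (A z) (B z) (b z) (d z))"
  define W where "W = (\<lambda>z. eils_multiplier p (A z) (B z) (b z) (d z))"
  obtain X' where X: "(X has_derivative X') (at z)"
    using diff(3) unfolding differentiable_def X_def by blast
  obtain W' where W: "(W has_derivative W') (at z)"
    using diff(4) unfolding differentiable_def W_def by blast
  note mv = bounded_bilinear.FDERIV[OF bounded_bilinear_matrix_vector_mult]
  note tr = bounded_linear.has_derivative[OF bounded_linear_transpose]
  note J = bounded_linear.has_derivative[OF matrix_vector_mul_bounded_linear]
  have near: "\<forall>\<^sub>F y in at z. invertible (eils_M p (A y)) \<and> invertible (eils_N p (A y) (B y))"
    using eventually_invertible[OF diff(1) M] eventually_invertible[OF diff(2) N]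
    by (rule eventually_conj)
  \<comment> \<open>An expression that is zero wherever M and N are invertible is zero on a whole
    neighbourhood of \<open>z\<close>, hence has derivative zero there.\<close>
  have vanish: "D h = 0" if "(f has_derivative D) (at z)"
    and "\<And>y. invertible (eils_M p (A y)) \<Longrightarrow> invertible (eils_N p (A y) (B y)) \<Longrightarrow> f y = 0"
    for f :: "'z \<Rightarrow> 'w::real_normed_vector" and D h
  proof -
    have "\<forall>\<^sub>F y in at z. f y = 0"
      by (rule eventually_mono[OF near]) (use that(2) in blast)
    from has_derivative_transform_eventually[OF that(1) this]
    have "((\<lambda>_. 0) has_derivative D) (at z)"
      using that(2)[OF M N] by simp
    then have "D = (\<lambda>_. 0)"
      using has_derivative_const by (rule has_derivative_unique)
    then show ?thesis by simp
  qed
  have X0: "X z = x" and W0: "W z = lam"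
    by (simp_all add: X_def W_def x lam)
  \<comment> \<open>Both KKT residuals are differentiated by the product rule, with the derivatives
    \<open>X'\<close> and \<open>W'\<close> as unknowns.\<close>
  have "((\<lambda>y. B y *v X y - d y) has_derivative (\<lambda>h. B z *v X' h + B' h *v X z - d' h)) (at z)"
    by (intro has_derivative_diff mv B X d)
  from vanish[OF this] have con: "B z *v X' h + B' h *v X z - d' h = 0" for h
    by (simp add: X_def eils_KKT(2))
  have "((\<lambda>y. transpose (A y) *v (signature_mat p *v (b y - A y *v X y)) + transpose (B y) *v W y)
    has_derivative
      (\<lambda>h. (transpose (A z) *v (signature_mat p *v (b' h - (A z *v X' h + A' h *v X z)))
        + transpose (A' h) *v (signature_mat p *v (b z - A z *v X z)))
      + (transpose (B z) *v W' h + transpose (B' h) *v W z))) (at z)"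
    by (intro has_derivative_add has_derivative_diff mv tr J A B X W b)
  from vanish[OF this]
  have grad: "(transpose (A z) *v (signature_mat p *v (b' h - (A z *v X' h + A' h *v X z)))
        + transpose (A' h) *v (signature_mat p *v (b z - A z *v X z)))
      + (transpose (B z) *v W' h + transpose (B' h) *v W z) = 0" for h
    by (simp add: X_def W_def eils_KKT(1))
  \<comment> \<open>The linearized system has the coefficients of the original one:
    \<open>W' h\<close> is its multiplier and is eliminated, while the perturbations of the data
    form the right-hand sides.\<close>
  have "X' h = (matrix_inv (eils_M p (A z)) ** transpose (B z) ** matrix_inv (eils_N p (A z) (B z)))
          *v (d' h - B' h *v x)
      - (matrix_inv (eils_M p (A z)) ** eils_P p (A z) (B z)) *v
        (transpose (A' h) *v (signature_mat p *v (b z - A z *v x))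
         + transpose (A z) *v (signature_mat p *v (b' h - A' h *v x))
         + transpose (B' h) *v lam)" for h
  proof (rule solve_linearized_KKT[OF M N])
    show "B z *v X' h = d' h - B' h *v x"
      using con[of h] by (simp add: X0 algebra_simps)
    show "eils_M p (A z) *v X' h = (transpose (A' h) *v (signature_mat p *v (b z - A z *v x))
        + transpose (A z) *v (signature_mat p *v (b' h - A' h *v x))
        + transpose (B' h) *v lam) + transpose (B z) *v W' h"
      using grad[of h]
      by (simp add: X0 W0 eils_M_def matrix_vector_mul_assoc[symmetric]
          matrix_vector_mult_diff_distrib matrix_vector_right_distrib algebra_simps)
  qed
  with X show ?thesis
    unfolding X_def[symmetric] by (rule has_derivative_eq_rhs[OF _ ext])
qed

subsection \<open>Reduction to an operator norm\<close>

lemma inner_matrix_outer: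
  fixes X :: "real^'n^'m"
  shows "X \<bullet> outer u v = u \<bullet> (X *v v)"
  by (simp add: outer_def inner_vec_def matrix_vector_mult_def sum_distrib_left mult_ac)

lemma outer_mult_vec: "outer u v *v w = (v \<bullet> w) *\<^sub>R u"
  by (simp add: outer_def inner_vec_def matrix_vector_mult_def vec_eq_iff sum_distrib_left mult_ac)

lemma inner_outer_outer: "outer u v \<bullet> outer w z = (u \<bullet> w) * (v \<bullet> z)"
  by (simp add: inner_matrix_outer outer_mult_vec inner_commute)

lemma transpose_outer: "transpose (outer u v) = outer v u"
  by (simp add: outer_def transpose_def vec_eq_iff mult_ac)

lemma transpose_diff: "transpose (X - Y :: real^'n^'m) = transpose X - transpose Y"
  by (simp add: transpose_def vec_eq_iff)

lemma transpose_add: "transpose (X + Y :: real^'n^'m) = transpose X + transpose Y"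
  by (simp add: transpose_def vec_eq_iff)

lemma transpose_scaleR: "transpose (c *\<^sub>R X :: real^'n^'m) = c *\<^sub>R transpose X"
  by (simp add: transpose_def vec_eq_iff)

text \<open>This is Z Z^T = X X^T + Y Y^T for Z = [X, Y], read as a bilinear form: a sum over a
  disjoint union of column indices splits in two.\<close>

lemma inner_transpose_hcat:
  fixes X :: "real^'a^'n" and Y :: "real^'b^'n"
  shows "(transpose (hcat X Y) *v y) \<bullet> (transpose (hcat X Y) *v z)
    = (transpose X *v y) \<bullet> (transpose X *v z) + (transpose Y *v y) \<bullet> (transpose Y *v z)"
proof -
  have "(transpose (hcat X Y) *v u) $ Inl i = (transpose X *v u) $ i"
    and "(transpose (hcat X Y) *v u) $ Inr j = (transpose Y *v u) $ j" for u i j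
    by (simp_all add: hcat_def transpose_def matrix_vector_mult_def)
  moreover have "sum f UNIV = (\<Sum>i\<in>UNIV. f (Inl i)) + (\<Sum>j\<in>UNIV. f (Inr j))" for f :: "'a + 'b \<Rightarrow> real"
    using sum.Plus[of UNIV UNIV f] by (simp add: o_def)
  ultimately show ?thesis
    by (simp only: inner_vec_def)
qed

lemma signature_mat_involution: "signature_mat p *v (signature_mat p *v u) = u"
  by (simp add: signature_mat_def matrix_vector_mult_def vec_eq_iff if_distrib[of "\<lambda>c. c * _"] sum.delta
      cong: if_cong)

lemma inner_signature_mat: "(signature_mat p *v u) \<bullet> v = u \<bullet> (signature_mat p *v v)"
  by (metis inner_transpose_matrix_vector transpose_signature_mat)

text \<open>Stationarity says B^T w = -A^T J r; applying B and inverting B B^T isolates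
  \<open>w\<close>. Thus the \<lambda> of the claim is the KKT multiplier.\<close>

lemma eils_multiplier_eq:
  fixes A :: "real^'n^('m::{finite,linorder})" and B :: "real^'n^'s"
  assumes rB: "rank B = CARD('s)"
    and kkt: "transpose A *v (signature_mat p *v r) + transpose B *v w = 0"
  shows "w = - ((matrix_inv (B ** transpose B) ** B ** transpose A ** signature_mat p) *v r)"
proof -
  have "(B ** transpose B) *v w = - (B *v (transpose A *v (signature_mat p *v r)))"
    using arg_cong[OF kkt, of "(*v) B"]
    by (simp add: matrix_vector_right_distrib matrix_vector_mul_assoc[symmetric] add_eq_0_iff)
  then have "w = matrix_inv (B ** transpose B) *v (- (B *v (transpose A *v (signature_mat p *v r))))"
    using matrix_inv_mult(2)[OF invertible_self_mult_transpose[OF rB], of w] by simp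
  then show ?thesis
    by (simp add: matrix_vector_mul_assoc matrix_mul_assoc linear_neg[OF matrix_vector_mul_linear])
qed

lemma weighted_data_norm_scale:
  assumes "0 < \<Phi>" "0 < \<Psi>" "0 < \<beta>" "0 < \<theta>"
  shows "weighted_data_norm \<Phi> \<Psi> \<beta> \<theta> ((1 / \<Phi>) *\<^sub>R a) ((1 / \<Psi>) *\<^sub>R b) ((1 / \<beta>) *\<^sub>R c) ((1 / \<theta>) *\<^sub>R e)
    = norm (a, b, c, e)"
  using assms by (simp add: weighted_data_norm_def norm_Pair power_mult_distrib power_divide)

text \<open>Dividing each data block by its weight turns the weighted norm into the norm of the
  product space, and \<xi> is absorbed into the map. The condition number becomes a limit of plain
  difference quotients.\<close>

lemma projected_cond_eq_onorm:
  fixes A :: "real^'n^('m::{finite,linorder})" and B :: "real^'n^'s"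
  assumes pos: "0 < \<Phi>" "0 < \<Psi>" "0 < \<beta>" "0 < \<theta>" "0 < \<xi>"
    and D: "((\<lambda>h. \<xi> *\<^sub>R projected_eils_map L p (A + (1 / \<Phi>) *\<^sub>R fst h) (B + (1 / \<Psi>) *\<^sub>R fst (snd h))
        (b + (1 / \<beta>) *\<^sub>R fst (snd (snd h))) (d + (1 / \<theta>) *\<^sub>R snd (snd (snd h)))) has_derivative D) (at 0)"
  shows "projected_cond \<Phi> \<Psi> \<beta> \<theta> \<xi> L p A B b d = ereal (onorm D)"
proof -
  define f where "f = (\<lambda>h. \<xi> *\<^sub>R projected_eils_map L p (A + (1 / \<Phi>) *\<^sub>R fst h) (B + (1 / \<Psi>) *\<^sub>R fst (snd h))
        (b + (1 / \<beta>) *\<^sub>R fst (snd (snd h))) (d + (1 / \<theta>) *\<^sub>R snd (snd (snd h))))"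
  \<comment> \<open>On the product type the norm is Euclidean, so \<open>T\<close> is an isometry onto the weighted data space.\<close>
  define T where "T h = ((1 / \<Phi>) *\<^sub>R fst h, (1 / \<Psi>) *\<^sub>R fst (snd h),
      (1 / \<beta>) *\<^sub>R fst (snd (snd h)), (1 / \<theta>) *\<^sub>R snd (snd (snd h)))"
    for h :: "(real^'n^('m::{finite,linorder})) \<times> (real^'n^'s) \<times> (real^('m::{finite,linorder})) \<times> (real^'s)"
  have norm_T: "(case T h of (a, b, c, e) \<Rightarrow> weighted_data_norm \<Phi> \<Psi> \<beta> \<theta> a b c e) = norm h" for h
    using weighted_data_norm_scale[OF pos(1-4), of "fst h" "fst (snd h)" "fst (snd (snd h))" "snd (snd (snd h))"]
    by (simp add: T_def)
  have surj_T: "\<exists>h. y = T h" for y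
    using pos
    by (intro exI[of _ "(\<Phi> *\<^sub>R fst y, \<Psi> *\<^sub>R fst (snd y), \<beta> *\<^sub>R fst (snd (snd y)), \<theta> *\<^sub>R snd (snd (snd y)))"])
      (simp add: T_def)
  \<comment> \<open>The admissible perturbations are the image under \<open>T\<close> of a punctured
    ball, so the supremum can be reindexed by \<open>h\<close>.\<close>
  have image: "{(a, b, c, e). 0 < weighted_data_norm \<Phi> \<Psi> \<beta> \<theta> a b c e
        \<and> weighted_data_norm \<Phi> \<Psi> \<beta> \<theta> a b c e \<le> \<delta>} = T ` {h. 0 < norm h \<and> norm h \<le> \<delta>}" (is "?S = _") for \<delta>
  proof -
    have mem: "T h \<in> ?S \<longleftrightarrow> 0 < norm h \<and> norm h \<le> \<delta>" for h
      using norm_T[of h] by (simp add: T_def)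
    show ?thesis
    proof (intro set_eqI iffI)
      fix y assume y: "y \<in> ?S"
      obtain h where h: "y = T h" using surj_T by metis
      show "y \<in> T ` {h. 0 < norm h \<and> norm h \<le> \<delta>}"
        using y unfolding h mem by (rule imageI[OF CollectI])
    next
      fix y assume "y \<in> T ` {h. 0 < norm h \<and> norm h \<le> \<delta>}"
      then obtain h where "y = T h" and "0 < norm h \<and> norm h \<le> \<delta>" by blast
      then show "y \<in> ?S" by (simp only: mem)
    qed
  qed
  have quotient: "(case T h of (a, b', c, e) \<Rightarrow> ereal (\<xi> * norm (projected_eils_map L p (A + a) (B + b') (b + c) (d + e)
          - projected_eils_map L p A B b d) / weighted_data_norm \<Phi> \<Psi> \<beta> \<theta> a b' c e))
      = ereal (norm (f (0 + h) - f 0) / norm h)" for h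
  proof -
    have "f h - f 0 = \<xi> *\<^sub>R (projected_eils_map L p (A + (1 / \<Phi>) *\<^sub>R fst h) (B + (1 / \<Psi>) *\<^sub>R fst (snd h))
        (b + (1 / \<beta>) *\<^sub>R fst (snd (snd h))) (d + (1 / \<theta>) *\<^sub>R snd (snd (snd h))) - projected_eils_map L p A B b d)"
      by (simp add: f_def scaleR_diff_right)
    then show ?thesis using norm_T[of h] pos by (simp add: T_def)
  qed
  have "((\<lambda>\<delta>. SUP h\<in>{h. 0 < norm h \<and> norm h \<le> \<delta>}. ereal (norm (f (0 + h) - f 0) / norm h))
    \<longlongrightarrow> ereal (onorm D)) (at_right 0)"
    using D unfolding f_def[symmetric] by (rule SUP_difference_quotient_tendsto_onorm)
  then show ?thesis
    unfolding projected_cond_def image image_image quotient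
    by (intro tendsto_Lim trivial_limit_at_right_real)
qed

subsection \<open>The adjoint of the derivative and the Gram identities\<close>

text \<open>Both sides expand to M^-1 B^T N^-1 B M^-1 - M^-1. As M^-1 is symmetric, this amounts to
  symmetry of K = M^-1 P.\<close>

lemma matrix_inv_eils_M_mult_eils_P:
  fixes A :: "real^'n^('m::{finite,linorder})"
  assumes "invertible (eils_M p A)" "invertible (eils_N p A B)"
  shows "matrix_inv (eils_M p A) ** eils_P p A B
      = transpose (eils_P p A B) ** matrix_inv (eils_M p A)"
proof -
  have "(matrix_inv (eils_M p A) ** eils_P p A B) *v v
      = (transpose (eils_P p A B) ** matrix_inv (eils_M p A)) *v v" for v
    unfolding transpose_eils_P[OF assms] unfolding eils_P_def
    by (simp only: matrix_vector_mul_assoc[symmetric] matrix_vector_mult_diff_distrib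
        matrix_vector_mult_diff_rdistrib matrix_vector_mul_lid)
  then show ?thesis by (simp add: matrix_eq)
qed

text \<open>\<open>Px\<close> is the orthogonal projector onto the complement of \<open>x\<close>,
  so the inner product loses exactly the contribution along \<open>x\<close>.\<close>

lemma inner_transpose_complement_projection:
  fixes x :: "real^'n"
  assumes "x \<noteq> 0"
  defines "Px \<equiv> mat 1 - (1 / (norm x)\<^sup>2) *\<^sub>R outer x x"
  shows "(transpose Px *v u) \<bullet> (transpose Px *v v) = u \<bullet> v - (x \<bullet> u) * (x \<bullet> v) / (norm x)\<^sup>2"
proof -
  have Px: "transpose Px *v w = w - ((x \<bullet> w) / (norm x)\<^sup>2) *\<^sub>R x" for w
    by (simp add: Px_def transpose_diff transpose_scaleR transpose_outer transpose_mat
        matrix_vector_mult_diff_rdistrib scaleR_matrix_vector_assoc[symmetric] outer_mult_vec)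
  show ?thesis
    unfolding Px inner_diff_left inner_diff_right inner_scaleR_left inner_scaleR_right
      inner_commute[of u x] power2_norm_eq_inner[symmetric]
    using assms(1) by (simp add: field_simps power2_eq_square flip: power2_norm_eq_inner)
qed

text \<open>Moving L^T, K, H, A and J to the other side leaves only \<open>u\<close> and
  \<open>v\<close> there. Each perturbed matrix then occurs in terms of the form a.(X c), which are
  Frobenius products of X with \<open>outer a c\<close>, so the adjoint can be read off block by
  block.\<close>

lemma data_derivative_adjoint:
  fixes A :: "real^'n^('m::{finite,linorder})" and B :: "real^'n^'s"
    and L :: "real^'k^'n" and K :: "real^'n^'n" and H :: "real^'s^'n"
    and h :: "(real^'n^('m::{finite,linorder})) \<times> (real^'n^'s) \<times> (real^('m::{finite,linorder})) \<times> (real^'s)"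
  assumes K: "transpose K = K"
    and u: "u = K *v (L *v y)" and v: "v = transpose H *v (L *v y)"
  shows "(\<xi> *\<^sub>R (transpose L *v (H *v ((1 / \<theta>) *\<^sub>R snd (snd (snd h)) - ((1 / \<Psi>) *\<^sub>R fst (snd h)) *v x)
      - K *v (transpose ((1 / \<Phi>) *\<^sub>R fst h) *v (signature_mat p *v r)
         + transpose A *v (signature_mat p *v ((1 / \<beta>) *\<^sub>R fst (snd (snd h)) - ((1 / \<Phi>) *\<^sub>R fst h) *v x))
         + transpose ((1 / \<Psi>) *\<^sub>R fst (snd h)) *v lam)))) \<bullet> y
    = h \<bullet> (\<xi> *\<^sub>R ((1 / \<Phi>) *\<^sub>R (outer (signature_mat p *v (A *v u)) x - outer (signature_mat p *v r) u),
         (- 1 / \<Psi>) *\<^sub>R (outer lam u + outer v x),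
         (- 1 / \<beta>) *\<^sub>R (signature_mat p *v (A *v u)),
         (1 / \<theta>) *\<^sub>R v))"
proof -
  obtain a b c e where h: "h = (a, b, c, e)" by (cases h)
  have L: "(transpose L *v w) \<bullet> y = w \<bullet> (L *v y)" for w
    using inner_transpose_matrix_vector[of y L w] by (simp add: inner_commute)
  have Kw: "(K *v w) \<bullet> (L *v y) = w \<bullet> u" for w
    using inner_transpose_matrix_vector[of w K "L *v y"] by (simp add: K u)
  have Hw: "(H *v w) \<bullet> (L *v y) = w \<bullet> v" for w
    using inner_transpose_matrix_vector[of w H "L *v y"] by (simp add: v)
  have T: "(transpose X *v w) \<bullet> u = w \<bullet> (X *v u)" for X :: "real^'n^'i" and w
    using inner_transpose_matrix_vector[of u X w] by (simp add: inner_commute)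
  have Ju: "(signature_mat p *v w) \<bullet> (A *v u) = w \<bullet> (signature_mat p *v (A *v u))" for w
    by (rule inner_signature_mat)
  have key: "(\<xi> *\<^sub>R (transpose L *v (H *v e' - K *v (transpose A' *v (signature_mat p *v r)
        + transpose A *v (signature_mat p *v c') + transpose B' *v lam)))) \<bullet> y
      = \<xi> * (e' \<bullet> v - ((signature_mat p *v r) \<bullet> (A' *v u) + c' \<bullet> (signature_mat p *v (A *v u))
        + lam \<bullet> (B' *v u)))" for A' :: "real^'n^('m::{finite,linorder})" and B' :: "real^'n^'s" and c' e'
    by (simp only: inner_scaleR_left L inner_diff_left inner_add_left Kw Hw T Ju)
  show ?thesis
    unfolding key h
    by (simp add: inner_diff_left inner_add_left inner_diff_right inner_add_right
        inner_matrix_outer scaleR_matrix_vector_assoc[symmetric] algebra_simps inner_commute)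
qed

text \<open>Every summand of \<open>MM\<close> starts with \<open>K\<close> or \<open>H\<close> and
  ends with \<open>K\<close> or the transpose of \<open>H\<close>, so its bilinear form depends on
  \<open>y\<close> and \<open>z\<close> only through \<open>u\<close>, \<open>v\<close>,
  \<open>u'\<close>, \<open>v'\<close>. The coefficients stay abstract to keep the weights out of
  the algebra.\<close>

lemma inner_MM:
  fixes A :: "real^'n^'m" and B :: "real^'n^'s" and Mi P K S MM :: "real^'n^'n"
    and Ni :: "real^'s^'s" and H :: "real^'s^'n"
  assumes K: "Mi ** P = K" "transpose P ** Mi = K" "transpose K = K"
    and H: "Mi ** transpose B ** Ni = H" "Ni ** B ** Mi = transpose H"
    and S: "S = s1 *\<^sub>R mat 1 + s2 *\<^sub>R (transpose A ** A)
              - s3 *\<^sub>R (outer x r ** A) - s3 *\<^sub>R (transpose A ** outer r x)"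
    and MM: "MM = Mi ** P ** S ** transpose P ** Mi
              + c1 *\<^sub>R (Mi ** P ** outer x lam ** Ni ** B ** Mi)
              + c1 *\<^sub>R (Mi ** transpose B ** Ni ** outer lam x ** transpose P ** Mi)
              + c2 *\<^sub>R (Mi ** transpose B ** (Ni ** Ni) ** B ** Mi)"
    and u: "u = K *v y" "u' = K *v z" and v: "v = transpose H *v y" "v' = transpose H *v z"
  shows "(MM *v y) \<bullet> z = s1 * (u \<bullet> u') + s2 * ((A *v u) \<bullet> (A *v u'))
      - s3 * ((r \<bullet> (A *v u)) * (x \<bullet> u') + (x \<bullet> u) * (r \<bullet> (A *v u')))
      + c1 * ((lam \<bullet> v) * (x \<bullet> u') + (x \<bullet> u) * (lam \<bullet> v')) + c2 * (v \<bullet> v')"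
proof -
  have "MM = (Mi ** P) ** S ** (transpose P ** Mi)
      + c1 *\<^sub>R ((Mi ** P) ** outer x lam ** (Ni ** B ** Mi))
      + c1 *\<^sub>R ((Mi ** transpose B ** Ni) ** outer lam x ** (transpose P ** Mi))
      + c2 *\<^sub>R ((Mi ** transpose B ** Ni) ** (Ni ** B ** Mi))"
    by (simp only: MM matrix_mul_assoc)
  then have MM: "MM = K ** S ** K + c1 *\<^sub>R (K ** outer x lam ** transpose H)
      + c1 *\<^sub>R (H ** outer lam x ** K) + c2 *\<^sub>R (H ** transpose H)"
    by (simp only: K H)
  have Kw: "(K *v w) \<bullet> z = w \<bullet> u'" for w
    using inner_transpose_matrix_vector[of w K z] by (simp add: K(3) u)
  have Hw: "(H *v w) \<bullet> z = w \<bullet> v'" for w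
    using inner_transpose_matrix_vector[of w H z] by (simp add: v)
  have T: "(transpose A *v w) \<bullet> u' = w \<bullet> (A *v u')" for w
    using inner_transpose_matrix_vector[of u' A w] by (simp add: inner_commute)
  have "(MM *v y) \<bullet> z = (S *v u) \<bullet> u' + c1 * ((lam \<bullet> v) * (x \<bullet> u'))
      + c1 * ((x \<bullet> u) * (lam \<bullet> v')) + c2 * (v \<bullet> v')"
    unfolding MM
    by (simp add: matrix_vector_mult_add_rdistrib scaleR_matrix_vector_assoc[symmetric]
        matrix_vector_mul_assoc[symmetric] inner_add_left Kw Hw outer_mult_vec u(1)[symmetric] v(1)[symmetric])
  moreover have "(S *v u) \<bullet> u' = s1 * (u \<bullet> u') + s2 * ((A *v u) \<bullet> (A *v u'))
      - s3 * ((r \<bullet> (A *v u)) * (x \<bullet> u')) - s3 * ((x \<bullet> u) * (r \<bullet> (A *v u')))"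
    unfolding S
    by (simp add: matrix_vector_mult_add_rdistrib matrix_vector_mult_diff_rdistrib
        scaleR_matrix_vector_assoc[symmetric] matrix_vector_mul_assoc[symmetric]
        inner_add_left inner_diff_left T outer_mult_vec)
  ultimately show ?thesis by (simp add: algebra_simps)
qed

lemma inner_signature_mat_both: "(signature_mat p *v a) \<bullet> (signature_mat p *v b) = a \<bullet> b"
  by (simp add: inner_signature_mat signature_mat_involution)

text \<open>J is symmetric with square I, so it cancels from all inner products, and products of
  rank-one matrices factor. The difference in the first block yields the negative mixed terms, the
  sum in the second block the positive ones. The result is the form of \<open>inner_MM\<close> with
  the coefficients of the claim.\<close>

lemma inner_data_adjoint:
  fixes A :: "real^'n^('m::{finite,linorder})"
  shows "((1 / \<Phi>) *\<^sub>R (outer (signature_mat p *v (A *v u)) x - outer (signature_mat p *v r) u),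
         (- 1 / \<Psi>) *\<^sub>R (outer lam u + outer v x),
         (- 1 / \<beta>) *\<^sub>R (signature_mat p *v (A *v u)),
         (1 / \<theta>) *\<^sub>R v)
     \<bullet> ((1 / \<Phi>) *\<^sub>R (outer (signature_mat p *v (A *v u')) x - outer (signature_mat p *v r) u'),
         (- 1 / \<Psi>) *\<^sub>R (outer lam u' + outer v' x),
         (- 1 / \<beta>) *\<^sub>R (signature_mat p *v (A *v u')),
         (1 / \<theta>) *\<^sub>R v')
    = ((norm lam)\<^sup>2 / \<Psi>\<^sup>2 + (norm r)\<^sup>2 / \<Phi>\<^sup>2) * (u \<bullet> u')
      + ((norm x)\<^sup>2 / \<Phi>\<^sup>2 + 1 / \<beta>\<^sup>2) * ((A *v u) \<bullet> (A *v u'))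
      - (1 / \<Phi>\<^sup>2) * ((r \<bullet> (A *v u)) * (x \<bullet> u') + (x \<bullet> u) * (r \<bullet> (A *v u')))
      + (1 / \<Psi>\<^sup>2) * ((lam \<bullet> v) * (x \<bullet> u') + (x \<bullet> u) * (lam \<bullet> v'))
      + ((norm x)\<^sup>2 / \<Psi>\<^sup>2 + 1 / \<theta>\<^sup>2) * (v \<bullet> v')"
proof -
  have 1: "(outer (signature_mat p *v (A *v u)) x - outer (signature_mat p *v r) u)
      \<bullet> (outer (signature_mat p *v (A *v u')) x - outer (signature_mat p *v r) u')
    = (norm x)\<^sup>2 * ((A *v u) \<bullet> (A *v u')) + (norm r)\<^sup>2 * (u \<bullet> u')
      - ((r \<bullet> (A *v u)) * (x \<bullet> u') + (x \<bullet> u) * (r \<bullet> (A *v u')))"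
    unfolding inner_diff_left inner_diff_right inner_outer_outer inner_signature_mat_both power2_norm_eq_inner
      inner_commute[of u x] inner_commute[of "A *v u" r]
    by (simp only: algebra_simps)
  have 2: "(outer lam u + outer v x) \<bullet> (outer lam u' + outer v' x)
    = (norm lam)\<^sup>2 * (u \<bullet> u') + (norm x)\<^sup>2 * (v \<bullet> v')
      + ((lam \<bullet> v) * (x \<bullet> u') + (x \<bullet> u) * (lam \<bullet> v'))"
    unfolding inner_add_left inner_add_right inner_outer_outer power2_norm_eq_inner
      inner_commute[of u x] inner_commute[of v lam]
    by (simp only: algebra_simps)
  show ?thesis
    unfolding inner_Pair inner_scaleR_left inner_scaleR_right 1 2 inner_signature_mat_both
    by (simp add: power2_eq_square add_divide_distrib diff_divide_distrib distrib_left distrib_right)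
qed

text \<open>The first and the last block leave surplus multiples of (x.u)(x.u'), which the deficits
  of the two projector blocks cancel exactly. The definitions of \<zeta> and \<gamma> make the
  remaining squared coefficients add up to those in \<open>inner_data_adjoint\<close>.\<close>

lemma inner_block_row:
  fixes A :: "real^'n^'m" and K :: "real^'n^'n" and H :: "real^'s^'n"
    and Q :: "real^('m + 'n + 'n + 'n + 'n)^'n"
  assumes K: "transpose K = K" and x: "x \<noteq> 0" and pos: "0 < \<Phi>" "0 < \<Psi>" "0 < \<beta>" "0 < \<theta>"
    and zeta: "\<zeta> = sqrt (\<beta>\<^sup>2 * (norm x)\<^sup>2 + \<Phi>\<^sup>2)"
    and gamma: "\<gamma> = sqrt (\<theta>\<^sup>2 * (norm x)\<^sup>2 + \<Psi>\<^sup>2)"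
    and Px: "Px = mat 1 - (1 / (norm x)\<^sup>2) *\<^sub>R outer x x"
    and Q: "Q = hcat ((\<zeta> / (\<Phi> * \<beta>)) *\<^sub>R transpose A - (\<beta> / (\<zeta> * \<Phi>)) *\<^sub>R outer x r)
               (hcat ((norm r / \<zeta>) *\<^sub>R mat 1)
               (hcat ((\<beta> * norm r * norm x / (\<zeta> * \<Phi>)) *\<^sub>R Px)
               (hcat ((norm lam / \<gamma>) *\<^sub>R mat 1)
                     ((\<theta> * norm lam * norm x / (\<gamma> * \<Psi>)) *\<^sub>R Px))))"
    and Z: "Z = hcat (K ** Q) ((\<gamma> / (\<Psi> * \<theta>)) *\<^sub>R H + (\<theta> / (\<Psi> * \<gamma>)) *\<^sub>R (K ** outer x lam))"
    and u: "u = K *v y" "u' = K *v z" and v: "v = transpose H *v y" "v' = transpose H *v z"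
  shows "(transpose Z *v y) \<bullet> (transpose Z *v z)
    = ((norm lam)\<^sup>2 / \<Psi>\<^sup>2 + (norm r)\<^sup>2 / \<Phi>\<^sup>2) * (u \<bullet> u')
      + ((norm x)\<^sup>2 / \<Phi>\<^sup>2 + 1 / \<beta>\<^sup>2) * ((A *v u) \<bullet> (A *v u'))
      - (1 / \<Phi>\<^sup>2) * ((r \<bullet> (A *v u)) * (x \<bullet> u') + (x \<bullet> u) * (r \<bullet> (A *v u')))
      + (1 / \<Psi>\<^sup>2) * ((lam \<bullet> v) * (x \<bullet> u') + (x \<bullet> u) * (lam \<bullet> v'))
      + ((norm x)\<^sup>2 / \<Psi>\<^sup>2 + 1 / \<theta>\<^sup>2) * (v \<bullet> v')"
proof -
  have z2: "\<zeta>\<^sup>2 = \<beta>\<^sup>2 * (norm x)\<^sup>2 + \<Phi>\<^sup>2" and g2: "\<gamma>\<^sup>2 = \<theta>\<^sup>2 * (norm x)\<^sup>2 + \<Psi>\<^sup>2"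
    by (simp_all add: zeta gamma)
  have z0: "0 < \<zeta>" and g0: "0 < \<gamma>"
    using pos by (simp_all add: zeta gamma add_nonneg_pos)
  have KQ: "transpose (K ** Q) *v w = transpose Q *v (K *v w)" for w
    by (simp add: matrix_transpose_mul K matrix_vector_mul_assoc)
  have Kx: "transpose (K ** outer x lam) *v w = (x \<bullet> (K *v w)) *\<^sub>R lam" for w
    by (simp add: matrix_transpose_mul K transpose_outer matrix_vector_mul_assoc[symmetric] outer_mult_vec)
  have first: "transpose ((\<zeta> / (\<Phi> * \<beta>)) *\<^sub>R transpose A - (\<beta> / (\<zeta> * \<Phi>)) *\<^sub>R outer x r) *v w
      = (\<zeta> / (\<Phi> * \<beta>)) *\<^sub>R (A *v w) - (\<beta> / (\<zeta> * \<Phi>) * (x \<bullet> w)) *\<^sub>R r" for w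
    by (simp add: transpose_diff transpose_scaleR transpose_outer matrix_vector_mult_diff_rdistrib
        scaleR_matrix_vector_assoc[symmetric] outer_mult_vec)
  have last: "transpose ((\<gamma> / (\<Psi> * \<theta>)) *\<^sub>R H + (\<theta> / (\<Psi> * \<gamma>)) *\<^sub>R (K ** outer x lam)) *v w
      = (\<gamma> / (\<Psi> * \<theta>)) *\<^sub>R (transpose H *v w) + (\<theta> / (\<Psi> * \<gamma>) * (x \<bullet> (K *v w))) *\<^sub>R lam" for w
    by (simp add: transpose_add transpose_scaleR matrix_vector_mult_add_rdistrib
        scaleR_matrix_vector_assoc[symmetric] Kx)
  have scaled: "transpose (c *\<^sub>R X) *v w = c *\<^sub>R (transpose X *v w)" for c and X :: "real^'n^'n" and w
    by (simp add: transpose_scaleR scaleR_matrix_vector_assoc)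
  have one: "transpose (mat 1) *v w = w" for w :: "real^'n"
    by (simp add: transpose_mat)
  note P = inner_transpose_complement_projection[OF x, folded Px]
  have 1: "(\<zeta> / (\<Phi> * \<beta>))\<^sup>2 = (norm x)\<^sup>2 / \<Phi>\<^sup>2 + 1 / \<beta>\<^sup>2"
    using pos by (simp add: power_divide power_mult_distrib z2 field_simps)
  have 2: "(\<gamma> / (\<Psi> * \<theta>))\<^sup>2 = (norm x)\<^sup>2 / \<Psi>\<^sup>2 + 1 / \<theta>\<^sup>2"
    using pos by (simp add: power_divide power_mult_distrib g2 field_simps)
  \<comment> \<open>Common source of facts 3 and 4: the identity block and the projector block
    together restore the coefficient of u.u'.\<close>
  have split: "(1 / b)\<^sup>2 + (a * nx / (b * c))\<^sup>2 = 1 / c\<^sup>2"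
    if "b\<^sup>2 = a\<^sup>2 * nx\<^sup>2 + c\<^sup>2" "0 < b" "0 < c" for a b c nx :: real
  proof -
    have "(1 / b)\<^sup>2 + (a * nx / (b * c))\<^sup>2 = (c\<^sup>2 + a\<^sup>2 * nx\<^sup>2) / (b\<^sup>2 * c\<^sup>2)"
      using that(2,3) by (simp add: power_divide power_mult_distrib field_simps)
    also have "c\<^sup>2 + a\<^sup>2 * nx\<^sup>2 = b\<^sup>2"
      using that(1) by simp
    finally show ?thesis using that(2) by simp
  qed
  have 3: "(norm r / \<zeta>)\<^sup>2 + (\<beta> * norm r * norm x / (\<zeta> * \<Phi>))\<^sup>2 = (norm r)\<^sup>2 / \<Phi>\<^sup>2"
    using arg_cong[OF split[OF z2 z0 pos(1)], of "\<lambda>t. (norm r)\<^sup>2 * t"]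
    by (simp add: distrib_left power_divide power_mult_distrib mult_ac)
  have 4: "(norm lam / \<gamma>)\<^sup>2 + (\<theta> * norm lam * norm x / (\<gamma> * \<Psi>))\<^sup>2 = (norm lam)\<^sup>2 / \<Psi>\<^sup>2"
    using arg_cong[OF split[OF g2 g0 pos(2)], of "\<lambda>t. (norm lam)\<^sup>2 * t"]
    by (simp add: distrib_left power_divide power_mult_distrib mult_ac)
  \<comment> \<open>Deficit of a projector block on the left, surplus of the first or last block on
    the right.\<close>
  have 5: "(\<beta> * norm r * norm x / (\<zeta> * \<Phi>))\<^sup>2 / (norm x)\<^sup>2 = (\<beta> / (\<zeta> * \<Phi>))\<^sup>2 * (norm r)\<^sup>2"
    "(\<theta> * norm lam * norm x / (\<gamma> * \<Psi>))\<^sup>2 / (norm x)\<^sup>2 = (\<theta> / (\<Psi> * \<gamma>))\<^sup>2 * (norm lam)\<^sup>2"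
    using x by (simp_all add: power_divide power_mult_distrib mult_ac)
  have cross: "\<zeta> / (\<Phi> * \<beta>) * (\<beta> / (\<zeta> * \<Phi>)) = 1 / \<Phi>\<^sup>2" "\<gamma> / (\<Psi> * \<theta>) * (\<theta> / (\<Psi> * \<gamma>)) = 1 / \<Psi>\<^sup>2"
    using pos z0 g0 by (simp_all add: power2_eq_square)
  have A: "(transpose ((\<zeta> / (\<Phi> * \<beta>)) *\<^sub>R transpose A - (\<beta> / (\<zeta> * \<Phi>)) *\<^sub>R outer x r) *v u)
      \<bullet> (transpose ((\<zeta> / (\<Phi> * \<beta>)) *\<^sub>R transpose A - (\<beta> / (\<zeta> * \<Phi>)) *\<^sub>R outer x r) *v u')
    = (\<zeta> / (\<Phi> * \<beta>))\<^sup>2 * ((A *v u) \<bullet> (A *v u'))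
      - (\<zeta> / (\<Phi> * \<beta>) * (\<beta> / (\<zeta> * \<Phi>))) * ((r \<bullet> (A *v u)) * (x \<bullet> u') + (x \<bullet> u) * (r \<bullet> (A *v u')))
      + (\<beta> / (\<zeta> * \<Phi>))\<^sup>2 * (norm r)\<^sup>2 * ((x \<bullet> u) * (x \<bullet> u'))"
    unfolding first inner_diff_left inner_diff_right inner_scaleR_left inner_scaleR_right
      power2_norm_eq_inner inner_commute[of "A *v u" r]
    by (simp only: power2_eq_square algebra_simps)
  have B: "(transpose ((\<gamma> / (\<Psi> * \<theta>)) *\<^sub>R H + (\<theta> / (\<Psi> * \<gamma>)) *\<^sub>R (K ** outer x lam)) *v y)
      \<bullet> (transpose ((\<gamma> / (\<Psi> * \<theta>)) *\<^sub>R H + (\<theta> / (\<Psi> * \<gamma>)) *\<^sub>R (K ** outer x lam)) *v z)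
    = (\<gamma> / (\<Psi> * \<theta>))\<^sup>2 * (v \<bullet> v')
      + (\<gamma> / (\<Psi> * \<theta>) * (\<theta> / (\<Psi> * \<gamma>))) * ((lam \<bullet> v) * (x \<bullet> u') + (x \<bullet> u) * (lam \<bullet> v'))
      + (\<theta> / (\<Psi> * \<gamma>))\<^sup>2 * (norm lam)\<^sup>2 * ((x \<bullet> u) * (x \<bullet> u'))"
    unfolding last u[symmetric] v[symmetric] inner_add_left inner_add_right inner_scaleR_left
      inner_scaleR_right power2_norm_eq_inner inner_commute[of v lam]
    by (simp only: power2_eq_square algebra_simps)
  have PP: "(transpose (c *\<^sub>R Px) *v u) \<bullet> (transpose (c *\<^sub>R Px) *v u')
      = c\<^sup>2 * (u \<bullet> u') - c\<^sup>2 / (norm x)\<^sup>2 * ((x \<bullet> u) * (x \<bullet> u'))" for c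
    unfolding scaled inner_scaleR_left inner_scaleR_right P
    by (simp add: power2_eq_square right_diff_distrib)
  have II: "(transpose (c *\<^sub>R mat 1) *v u) \<bullet> (transpose (c *\<^sub>R mat 1) *v u') = c\<^sup>2 * (u \<bullet> u')" for c
    unfolding scaled one inner_scaleR_left inner_scaleR_right by (simp add: power2_eq_square)
  \<comment> \<open>Facts 3 and 4 are used backwards, splitting the coefficients of the goal into
    the block contributions; the surplus terms then cancel by ring arithmetic.\<close>
  show ?thesis
    unfolding Z inner_transpose_hcat KQ u[symmetric]
    unfolding Q inner_transpose_hcat A B PP II 5 1 2 cross 3[symmetric] 4[symmetric]
    by (simp only: algebra_simps)
qed

section \<open>Both closed forms as factorizations of one Gram matrix\<close>

theorem theorem3p3:
  fixes A :: "real^'n^('m::{finite,linorder})" and B :: "real^'n^'s"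
    and b :: "real^('m::{finite,linorder})" and d :: "real^'s"
    and L :: "real^'k^'n"
    and p q :: nat
    and x :: "real^'n" and r :: "real^('m::{finite,linorder})" and lam :: "real^'s"
    and M P S Px MM :: "real^'n^'n" and N :: "real^'s^'s"
    and Q :: "real^('m::{finite,linorder} + 'n + 'n + 'n + 'n)^'n"
    and \<Phi> \<Psi> \<beta> \<theta> \<xi> \<zeta> \<gamma> :: real
  assumes pq: "p + q = CARD('m)"
    and rank_B: "rank B = CARD('s)"
    and posdef: "positive_definite (transpose A ** signature_mat p ** A)"
    and x: "eils_solution p A B b d x"
    and M: "M = eils_M p A"
    and N: "N = eils_N p A B"
    and P: "P = eils_P p A B"
    and r: "r = b - A *v x"
    and lam_eq: "lam = - ((matrix_inv (B ** transpose B) ** B ** transpose A ** signature_mat p) *v r)"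
    and rank_L: "rank L = CARD('k)"
    and pos: "0 < \<Phi>" "0 < \<Psi>" "0 < \<beta>" "0 < \<theta>" "0 < \<xi>"
    and zeta: "\<zeta> = sqrt (\<beta>\<^sup>2 * (norm x)\<^sup>2 + \<Phi>\<^sup>2)"
    and gamma: "\<gamma> = sqrt (\<theta>\<^sup>2 * (norm x)\<^sup>2 + \<Psi>\<^sup>2)"
    and S: "S = ((norm lam)\<^sup>2 / \<Psi>\<^sup>2 + (norm r)\<^sup>2 / \<Phi>\<^sup>2) *\<^sub>R mat 1
              + ((norm x)\<^sup>2 / \<Phi>\<^sup>2 + 1 / \<beta>\<^sup>2) *\<^sub>R (transpose A ** A)
              - (1 / \<Phi>\<^sup>2) *\<^sub>R (outer x r ** A)
              - (1 / \<Phi>\<^sup>2) *\<^sub>R (transpose A ** outer r x)"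
    and MM: "MM = matrix_inv M ** P ** S ** transpose P ** matrix_inv M
              + (1 / \<Psi>\<^sup>2) *\<^sub>R (matrix_inv M ** P ** outer x lam ** matrix_inv N ** B ** matrix_inv M)
              + (1 / \<Psi>\<^sup>2) *\<^sub>R (matrix_inv M ** transpose B ** matrix_inv N ** outer lam x
                                ** transpose P ** matrix_inv M)
              + ((norm x)\<^sup>2 / \<Psi>\<^sup>2 + 1 / \<theta>\<^sup>2) *\<^sub>R
                  (matrix_inv M ** transpose B ** (matrix_inv N ** matrix_inv N) ** B ** matrix_inv M)"
    and Px: "Px = mat 1 - (1 / (norm x)\<^sup>2) *\<^sub>R outer x x"
    and Q: "Q = hcat ((\<zeta> / (\<Phi> * \<beta>)) *\<^sub>R transpose A - (\<beta> / (\<zeta> * \<Phi>)) *\<^sub>R outer x r)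
               (hcat ((norm r / \<zeta>) *\<^sub>R mat 1)
               (hcat ((\<beta> * norm r * norm x / (\<zeta> * \<Phi>)) *\<^sub>R Px)
               (hcat ((norm lam / \<gamma>) *\<^sub>R mat 1)
                     ((\<theta> * norm lam * norm x / (\<gamma> * \<Psi>)) *\<^sub>R Px))))"
  shows "projected_cond \<Phi> \<Psi> \<beta> \<theta> \<xi> L p A B b d
           = ereal (sqrt (spectral_norm (\<xi>\<^sup>2 *\<^sub>R (transpose L ** MM ** L))))
       \<and> (x \<noteq> 0 \<longrightarrow>
          projected_cond \<Phi> \<Psi> \<beta> \<theta> \<xi> L p A B b d
           = ereal (spectral_norm (\<xi> *\<^sub>R (transpose L **
               hcat (matrix_inv M ** P ** Q)
                    ((\<gamma> / (\<Psi> * \<theta>)) *\<^sub>R (matrix_inv M ** transpose B ** matrix_inv N)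
                     + (\<theta> / (\<Psi> * \<gamma>)) *\<^sub>R (matrix_inv M ** P ** outer x lam))))))"
proof -
  define Mi Ni K H where "Mi = matrix_inv M" and "Ni = matrix_inv N" and "K = Mi ** P"
    and "H = Mi ** transpose B ** Ni"
  have pd: "positive_definite (eils_M p A)"
    using posdef by (simp add: eils_M_def)
  note invM = positive_definite_invertible[OF pd] and invN = invertible_eils_N[OF rank_B pd]
  have x': "x = eils_map p A B b d"
    using x eils_solution_iff_eils_map[OF rank_B pd] by blast
  have lam': "lam = eils_multiplier p A B b d"
    unfolding lam_eq r x' using eils_multiplier_eq[OF rank_B eils_KKT(1)[OF invM invN]] by (rule sym)
  have symMi: "transpose Mi = Mi" and symNi: "transpose Ni = Ni"
    by (simp_all add: Mi_def Ni_def M N transpose_matrix_inv_eils_M[OF invM]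
        transpose_matrix_inv_eils_N[OF invM invN])
  have K: "Mi ** P = K" "transpose P ** Mi = K"
    using matrix_inv_eils_M_mult_eils_P[OF invM invN] by (simp_all add: K_def Mi_def M P)
  have symK: "transpose K = K"
    using K(2) unfolding K_def matrix_transpose_mul symMi .
  have H: "Mi ** transpose B ** Ni = H" "Ni ** B ** Mi = transpose H"
    by (simp_all add: H_def matrix_transpose_mul symMi symNi matrix_mul_assoc)
  note MM' = inner_MM[OF K symK H S MM[folded Mi_def Ni_def] refl refl refl refl]
  \<comment> \<open>\<open>C\<close> is the common Gram matrix, \<open>D\<close> the derivative in
    rescaled data, and \<open>G\<close> its adjoint as found in
    \<open>data_derivative_adjoint\<close>.\<close>
  define C where "C = \<xi>\<^sup>2 *\<^sub>R (transpose L ** MM ** L)"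
  have C: "(C *v y) \<bullet> z = \<xi>\<^sup>2 * ((MM *v (L *v y)) \<bullet> (L *v z))" for y z
    using inner_transpose_matrix_vector[of z L "MM *v (L *v y)"]
    by (simp add: C_def scaleR_matrix_vector_assoc[symmetric] matrix_vector_mul_assoc[symmetric]
        inner_commute)
  define D where "D h = \<xi> *\<^sub>R (transpose L *v
      (H *v ((1 / \<theta>) *\<^sub>R snd (snd (snd h)) - ((1 / \<Psi>) *\<^sub>R fst (snd h)) *v x)
      - K *v (transpose ((1 / \<Phi>) *\<^sub>R fst h) *v (signature_mat p *v r)
         + transpose A *v (signature_mat p *v ((1 / \<beta>) *\<^sub>R fst (snd (snd h)) - ((1 / \<Phi>) *\<^sub>R fst h) *v x))
         + transpose ((1 / \<Psi>) *\<^sub>R fst (snd h)) *v lam)))"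
    for h :: "(real^'n^('m::{finite,linorder})) \<times> (real^'n^'s) \<times> (real^('m::{finite,linorder})) \<times> (real^'s)"
  define G where "G y = \<xi> *\<^sub>R
      ((1 / \<Phi>) *\<^sub>R (outer (signature_mat p *v (A *v (K *v (L *v y)))) x
          - outer (signature_mat p *v r) (K *v (L *v y))),
       (- 1 / \<Psi>) *\<^sub>R (outer lam (K *v (L *v y)) + outer (transpose H *v (L *v y)) x),
       (- 1 / \<beta>) *\<^sub>R (signature_mat p *v (A *v (K *v (L *v y)))),
       (1 / \<theta>) *\<^sub>R (transpose H *v (L *v y)))" for y
  have deriv: "((\<lambda>h. \<xi> *\<^sub>R projected_eils_map L p (A + (1 / \<Phi>) *\<^sub>R fst h) (B + (1 / \<Psi>) *\<^sub>R fst (snd h))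
        (b + (1 / \<beta>) *\<^sub>R fst (snd (snd h))) (d + (1 / \<theta>) *\<^sub>R snd (snd (snd h)))) has_derivative D) (at 0)"
  proof -
    let ?A = "\<lambda>h. A + (1 / \<Phi>) *\<^sub>R fst h" and ?B = "\<lambda>h. B + (1 / \<Psi>) *\<^sub>R fst (snd h)"
      and ?b = "\<lambda>h. b + (1 / \<beta>) *\<^sub>R fst (snd (snd h))"
      and ?d = "\<lambda>h. d + (1 / \<theta>) *\<^sub>R snd (snd (snd h))"
    have data: "(?A has_derivative (\<lambda>h. (1 / \<Phi>) *\<^sub>R fst h)) (at 0)"
      "(?B has_derivative (\<lambda>h. (1 / \<Psi>) *\<^sub>R fst (snd h))) (at 0)"
      "(?b has_derivative (\<lambda>h. (1 / \<beta>) *\<^sub>R fst (snd (snd h)))) (at 0)"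
      "(?d has_derivative (\<lambda>h. (1 / \<theta>) *\<^sub>R snd (snd (snd h)))) (at 0)"
      by (auto intro!: derivative_eq_intros)
    have base: "?A 0 = A" "?B 0 = B" "?b 0 = b" "?d 0 = d"
      by simp_all
    have "((\<lambda>h. eils_map p (A + (1 / \<Phi>) *\<^sub>R fst h) (B + (1 / \<Psi>) *\<^sub>R fst (snd h))
        (b + (1 / \<beta>) *\<^sub>R fst (snd (snd h))) (d + (1 / \<theta>) *\<^sub>R snd (snd (snd h)))) has_derivative
      (\<lambda>h. H *v ((1 / \<theta>) *\<^sub>R snd (snd (snd h)) - ((1 / \<Psi>) *\<^sub>R fst (snd h)) *v x)
      - K *v (transpose ((1 / \<Phi>) *\<^sub>R fst h) *v (signature_mat p *v r)
         + transpose A *v (signature_mat p *v ((1 / \<beta>) *\<^sub>R fst (snd (snd h)) - ((1 / \<Phi>) *\<^sub>R fst h) *v x))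
         + transpose ((1 / \<Psi>) *\<^sub>R fst (snd h)) *v lam))) (at 0)"
      unfolding H_def K_def Mi_def Ni_def M N P r
      by (rule has_derivative_eils_map[OF data, unfolded base, OF invM invN x' lam'])
    then show ?thesis
      unfolding projected_eils_map_def D_def
      by (intro has_derivative_scaleR_right bounded_linear.has_derivative[OF matrix_vector_mul_bounded_linear])
  qed
  have D: "bounded_linear D"
    using deriv by (rule has_derivative_bounded_linear)
  have adj: "D h \<bullet> y = h \<bullet> G y" for h y
    unfolding D_def G_def by (rule data_derivative_adjoint[OF symK refl refl])
  \<comment> \<open>Linearity is inherited through \<open>adj\<close>: inner products with
    \<open>G y\<close> are linear in \<open>y\<close>, and they determine
    \<open>G y\<close>.\<close>
  have G: "bounded_linear G"
    unfolding linear_conv_bounded_linear[symmetric]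
    by (rule linearI; rule vector_eq_rdot[THEN iffD1], rule allI)
      (simp_all add: adj[symmetric] inner_add_left inner_add_right inner_commute[of "G _"])
  have gram: "(C *v y) \<bullet> z = G y \<bullet> G z" for y z
    unfolding C MM' G_def inner_scaleR_left inner_scaleR_right inner_data_adjoint
    by (simp add: power2_eq_square)
  have cond: "projected_cond \<Phi> \<Psi> \<beta> \<theta> \<xi> L p A B b d = ereal (sqrt (onorm ((*v) C)))"
    using projected_cond_eq_onorm[OF pos deriv]
      onorm_eq_sqrt_onorm_gram[OF D G matrix_vector_mul_bounded_linear adj gram] by simp
  show ?thesis
  proof (intro conjI impI)
    show "projected_cond \<Phi> \<Psi> \<beta> \<theta> \<xi> L p A B b d
        = ereal (sqrt (spectral_norm (\<xi>\<^sup>2 *\<^sub>R (transpose L ** MM ** L))))"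
      unfolding cond spectral_norm_def C_def ..
  next
    assume x0: "x \<noteq> 0"
    define Z where "Z = hcat (K ** Q) ((\<gamma> / (\<Psi> * \<theta>)) *\<^sub>R H + (\<theta> / (\<Psi> * \<gamma>)) *\<^sub>R (K ** outer x lam))"
    \<comment> \<open>The transpose of \<open>W\<close> has the same Gram form as \<open>G\<close>,
      so \<open>W\<close> and \<open>D\<close> have the same operator norm.\<close>
    define W where "W = \<xi> *\<^sub>R (transpose L ** Z)"
    have W: "transpose W *v y = \<xi> *\<^sub>R (transpose Z *v (L *v y))" for y
      by (simp add: W_def transpose_scaleR matrix_transpose_mul scaleR_matrix_vector_assoc[symmetric]
          matrix_vector_mul_assoc[symmetric])
    note Z' = inner_block_row[OF symK x0 pos(1-4) zeta gamma Px Q Z_def refl refl refl refl]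
    have "(C *v y) \<bullet> z = (transpose W *v y) \<bullet> (transpose W *v z)" for y z
      unfolding C MM' W inner_scaleR_left inner_scaleR_right Z' by (simp add: power2_eq_square)
    moreover have "(W *v w) \<bullet> y = w \<bullet> (transpose W *v y)" for w y
      by (rule inner_transpose_matrix_vector[symmetric])
    ultimately have "onorm ((*v) W) = sqrt (onorm ((*v) C))"
      by (intro onorm_eq_sqrt_onorm_gram) auto
    then show "projected_cond \<Phi> \<Psi> \<beta> \<theta> \<xi> L p A B b d
           = ereal (spectral_norm (\<xi> *\<^sub>R (transpose L **
               hcat (matrix_inv M ** P ** Q)
                    ((\<gamma> / (\<Psi> * \<theta>)) *\<^sub>R (matrix_inv M ** transpose B ** matrix_inv N)
                     + (\<theta> / (\<Psi> * \<gamma>)) *\<^sub>R (matrix_inv M ** P ** outer x lam)))))"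
      unfolding cond spectral_norm_def Mi_def[symmetric] Ni_def[symmetric] K(1) H(1)
        Z_def[symmetric] W_def[symmetric] by simp
  qed
qed

end
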